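(* The leaf closures of any strongly equicontinuous, compact foliated space $(X,\mathcal F)$ define a partition of $X$.
   Context: **Foliated spaces.** A locally compact Polish space $X$ is a foliated space if it has an open cover $\{U_i\}$ with homeomorphisms $\phi_i:U_i\to B_i\times Z_i$ (flow boxes), $B_i$ an open ball of finite radius in $\mathbb R^n$, $Z_i$ a Polish space, with coordinate changes $\phi_i\circ\phi_j^{-1}(x_j,z_j)=(x_i(x_j,z_j),z_i(z_j))$, $z_i$ continuous, and $x_i$ of class $C^k$ in the sense that its partial derivatives up to order $k$ in the $\mathbb R^n$-directions exist and are continuous in $(x_j,z_j)$. The sets $\phi_i^{-1}(B_i\times\{z\})$ are plaques. The leaves are the connected components of $X$ in the finer topology with basis the open subsets of plaques. **Holonomy pseudogroup.** Let $p_i:U_i\to Z_i$ be the composite of $\phi_i$ with the projection $B_i\times Z_i\to Z_i$, and $Z_{i,j}=p_i(U_i\cap U_j)$. For a suitable (regular) cover there are homeomorphisms $h_{i,j}:Z_{i,j}\to Z_{j,i}$ with $p_j=h_{i,j}\circ p_i$ on $U_i\cap U_j$. The $h_{i,j}$ generate a pseudogroup $\mathcal H$ on $Z=\bigsqcup_iZ_i$, the holonomy pseudogroup. **Pseudogroups.** A pseudogroup of local transformations of a space $Z$ is a collection $\mathcal H$ of homeomorphisms between open subsets of $Z$ containing $\mathrm{id}_Z$ and closed under composition (wherever defined), inversion, restriction to open sets and combination (union) of maps. It is generated by $E\subset\mathcal H$ if all its elements are obtained from $E$ by these operations. $E$ is symmetric if $h\in E\Rightarrow h^{-1}\in E$.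 **Quasi-local metrics.** A cover of a set $Z$ by quasi-locally equal metric spaces is a family $\{(Z_i,d_i)\}_{i\in I}$ of metric spaces with $Z=\bigcup_iZ_i$, each $Z_i\cap Z_j$ open in $(Z_i,d_i)$ and in $(Z_j,d_j)$, such that for all $\varepsilon>0$ there is $\delta(\varepsilon)>0$ so that: for all $i,j\in I$ and $z\in Z_i\cap Z_j$ there is an open neighborhood $U_{i,j,z}$ of $z$ in $Z_i\cap Z_j$ with $d_i(x,y)<\delta(\varepsilon)\Rightarrow d_j(x,y)<\varepsilon$ for all $\varepsilon>0$ and $x,y\in U_{i,j,z}$. Two such families are equivalent if their union is again such a family; an equivalence class $\mathfrak Q$ is a quasi-local metric. It induces a topology on $Z$ with base the open balls of all $(Z_i,d_i)$. **Strong equicontinuity.** A pseudogroup $\mathcal H$ on a space $Z$ is strongly equicontinuous if there are a quasi-local metric $\mathfrak Q$ inducing the topology of $Z$, some $\{(Z_i,d_i)\}_{i\in I}\in\mathfrak Q$ and a symmetric set $S$ of generators of $\mathcal H$, closed under compositions, such that for every $\varepsilon>0$ there is $\delta(\varepsilon)>0$ with $d_i(x,y)<\delta(\varepsilon)\Rightarrow d_j(h(x),h(y))<\varepsilon$ for all $h\in S$, $i,j\in I$ and $x,y\in Z_i\cap h^{-1}(Z_j\cap\operatorname{im}h)$. A foliated space is strongly equicontinuous if its holonomy pseudogroup is (this is independent of the chosen representative). *)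

theory Defs
  imports "HOL-Analysis.Analysis"
begin

section \<open>Foliated spaces\<close>

definition polish_topology :: "'a topology \<Rightarrow> bool" where
  "polish_topology X \<longleftrightarrow> completely_metrizable_space X \<and> separable_space X"

text \<open>
  The model of \<open>\<real>\<^sup>n\<close> is the library's \<^const>\<open>Euclidean_space\<close> \<open>n\<close>, whose points are the
  functions \<open>nat \<Rightarrow> real\<close> vanishing at all indices \<open>\<ge> n\<close>, so that \<open>n\<close> is an ordinary natural number.
\<close>

definition Euclidean_ball :: "nat \<Rightarrow> (nat \<Rightarrow> real) \<Rightarrow> real \<Rightarrow> (nat \<Rightarrow> real) set" where
  "Euclidean_ball n a r = {x \<in> topspace (Euclidean_space n). sqrt (\<Sum>i<n. (x i - a i)\<^sup>2) < r}"

text \<open>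
  A flow box \<open>\<phi> : U \<rightarrow> B \<times> Z\<close>. The values of \<open>\<phi>\<close> outside \<open>U\<close> are irrelevant.
\<close>

record ('a, 'z) flow_box =
  fb_dom :: "'a set"
  fb_ball :: "(nat \<Rightarrow> real) set"
  fb_trans :: "'z topology"
  fb_map :: "'a \<Rightarrow> (nat \<Rightarrow> real) \<times> 'z"

definition fb_proj :: "('a, 'z) flow_box \<Rightarrow> 'a \<Rightarrow> 'z" where
  "fb_proj c x = snd (fb_map c x)"

definition flow_box_on :: "nat \<Rightarrow> 'a topology \<Rightarrow> ('a, 'z) flow_box \<Rightarrow> bool" where
  "flow_box_on n X c \<longleftrightarrow>
     openin X (fb_dom c) \<and>
     (\<exists>a \<in> topspace (Euclidean_space n). \<exists>r>0. fb_ball c = Euclidean_ball n a r) \<and>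
     polish_topology (fb_trans c) \<and>
     homeomorphic_map (subtopology X (fb_dom c))
       (prod_topology (subtopology (Euclidean_space n) (fb_ball c)) (fb_trans c)) (fb_map c)"

text \<open>
  For a real function \<open>f\<close> on an open subset \<open>W\<close> of \<open>\<real>\<^sup>n \<times> Z\<close>: all iterated partial derivatives of order
  at most \<open>k\<close> in the \<open>\<real>\<^sup>n\<close>-directions exist on \<open>W\<close> and are continuous on \<open>W\<close>, jointly in the
  two variables. Here \<open>x(i := t)\<close> moves the \<open>i\<close>-th coordinate, and \<open>g\<close> is the partial derivative.
\<close>

primrec leafwise_C ::
  "nat \<Rightarrow> 'z topology \<Rightarrow> ((nat \<Rightarrow> real) \<times> 'z) set \<Rightarrow> nat \<Rightarrow> ((nat \<Rightarrow> real) \<times> 'z \<Rightarrow> real) \<Rightarrow> bool"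
where
  "leafwise_C n Z W 0 f \<longleftrightarrow>
     continuous_map (subtopology (prod_topology (Euclidean_space n) Z) W) euclideanreal f"
| "leafwise_C n Z W (Suc k) f \<longleftrightarrow>
     continuous_map (subtopology (prod_topology (Euclidean_space n) Z) W) euclideanreal f \<and>
     (\<forall>i<n. \<exists>g. (\<forall>(x, z) \<in> W.
          ((\<lambda>t. f (x(i := t), z)) has_real_derivative g (x, z)) (at (x i))) \<and>
        leafwise_C n Z W k g)"

text \<open>
  The coordinate change \<open>\<phi>\<^sub>c \<circ> \<phi>\<^sub>d\<inverse>\<close>, defined on \<open>\<phi>\<^sub>d (U\<^sub>c \<inter> U\<^sub>d)\<close>, has the form
  \<open>(x, z) \<mapsto> (\<xi> (x, z), \<zeta> z)\<close>. As usual for foliated atlases, the transverse map \<open>\<zeta>\<close> is only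
  required near each point of \<open>U\<^sub>c \<inter> U\<^sub>d\<close>; its existence on all of \<open>U\<^sub>c \<inter> U\<^sub>d\<close> is a
  property of regular atlases (see below).
\<close>

definition foliated_change ::
  "nat \<Rightarrow> enat \<Rightarrow> 'a topology \<Rightarrow> ('a, 'z) flow_box \<Rightarrow> ('a, 'z) flow_box \<Rightarrow> bool" where
  "foliated_change n k X c d \<longleftrightarrow>
     (\<forall>x \<in> fb_dom c \<inter> fb_dom d. \<exists>N \<zeta>. openin X N \<and> x \<in> N \<and> N \<subseteq> fb_dom c \<inter> fb_dom d \<and>
        continuous_map (subtopology (fb_trans d) (fb_proj d ` N)) (fb_trans c) \<zeta> \<and>
        (\<forall>y \<in> N. fb_proj c y = \<zeta> (fb_proj d y))) \<and>
     (\<forall>i<n. \<forall>m. enat m \<le> k \<longrightarrow>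
        leafwise_C n (fb_trans d) (fb_map d ` (fb_dom c \<inter> fb_dom d)) m
          (\<lambda>q. fst (fb_map c (inv_into (fb_dom d) (fb_map d) q)) i))"

definition foliated_space :: "nat \<Rightarrow> enat \<Rightarrow> 'a topology \<Rightarrow> ('a, 'z) flow_box set \<Rightarrow> bool" where
  "foliated_space n k X A \<longleftrightarrow>
     locally_compact_space X \<and> polish_topology X \<and>
     (\<forall>c \<in> A. flow_box_on n X c) \<and> \<Union> (fb_dom ` A) = topspace X \<and>
     (\<forall>c \<in> A. \<forall>d \<in> A. foliated_change n k X c d)"

definition plaque :: "('a, 'z) flow_box \<Rightarrow> 'z \<Rightarrow> 'a set" where
  "plaque c z = {x \<in> fb_dom c. fb_proj c x = z}"

definition leaf_topology :: "'a topology \<Rightarrow> ('a, 'z) flow_box set \<Rightarrow> 'a topology" where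
  "leaf_topology X A = topology_generated_by
     {V. \<exists>c \<in> A. \<exists>z \<in> topspace (fb_trans c). openin (subtopology X (plaque c z)) V}"

definition leaves :: "'a topology \<Rightarrow> ('a, 'z) flow_box set \<Rightarrow> 'a set set" where
  "leaves X A = connected_components_of (leaf_topology X A)"


section \<open>Pseudogroups\<close>

text \<open>
  A homeomorphism between open subsets of a space \<open>T\<close> is represented by its graph. Composition,
  inversion, restriction to an open set \<open>W\<close> and combination of such maps are then relational
  composition, converse, \<open>Id_on W O h\<close> and union.
\<close>

definition local_transformation :: "'b topology \<Rightarrow> 'b rel \<Rightarrow> bool" where
  "local_transformation T h \<longleftrightarrow>
     (\<exists>U V f. openin T U \<and> openin T V \<and>
        homeomorphic_map (subtopology T U) (subtopology T V) f \<and> h = {(x, f x) |x. x \<in> U})"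

definition pseudogroup :: "'b topology \<Rightarrow> 'b rel set \<Rightarrow> bool" where
  "pseudogroup T H \<longleftrightarrow>
     (\<forall>h \<in> H. local_transformation T h) \<and>
     Id_on (topspace T) \<in> H \<and>
     (\<forall>g \<in> H. \<forall>h \<in> H. g O h \<in> H) \<and>
     (\<forall>h \<in> H. h\<inverse> \<in> H) \<and>
     (\<forall>h \<in> H. \<forall>W. openin T W \<longrightarrow> Id_on W O h \<in> H) \<and>
     (\<forall>F. F \<subseteq> H \<longrightarrow> local_transformation T (\<Union>F) \<longrightarrow> \<Union>F \<in> H)"

inductive_set generated_pseudogroup :: "'b topology \<Rightarrow> 'b rel set \<Rightarrow> 'b rel set"
  for T :: "'b topology" and E :: "'b rel set" where
  gen_base: "h \<in> E \<Longrightarrow> h \<in> generated_pseudogroup T E"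
| gen_id: "Id_on (topspace T) \<in> generated_pseudogroup T E"
| gen_comp: "g \<in> generated_pseudogroup T E \<Longrightarrow> h \<in> generated_pseudogroup T E \<Longrightarrow>
    g O h \<in> generated_pseudogroup T E"
| gen_inv: "h \<in> generated_pseudogroup T E \<Longrightarrow> h\<inverse> \<in> generated_pseudogroup T E"
| gen_restrict: "h \<in> generated_pseudogroup T E \<Longrightarrow> openin T W \<Longrightarrow>
    Id_on W O h \<in> generated_pseudogroup T E"
| gen_union: "(\<And>h. h \<in> F \<Longrightarrow> h \<in> generated_pseudogroup T E) \<Longrightarrow> local_transformation T (\<Union>F) \<Longrightarrow>
    \<Union>F \<in> generated_pseudogroup T E"


section \<open>Quasi-local metrics and strong equicontinuity\<close>

text \<open>
  Families of metric spaces are represented as sets of metric spaces: none of the conditions below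
  depends on the indexing. The neighbourhood \<open>U\<close> does not depend on \<open>\<epsilon>\<close>. Since the condition is
  symmetric in \<open>m\<close> and \<open>m'\<close>, both metrics induce the same topology on the overlap.
\<close>

definition quasi_locally_equal_cover :: "'b set \<Rightarrow> 'b metric set \<Rightarrow> bool" where
  "quasi_locally_equal_cover Z Q \<longleftrightarrow>
     \<Union> (mspace ` Q) = Z \<and>
     (\<forall>m \<in> Q. \<forall>m' \<in> Q. openin (mtopology_of m) (mspace m \<inter> mspace m') \<and>
                     openin (mtopology_of m') (mspace m \<inter> mspace m')) \<and>
     (\<exists>\<delta> :: real \<Rightarrow> real. (\<forall>\<epsilon>>0. \<delta> \<epsilon> > 0) \<and>
        (\<forall>m \<in> Q. \<forall>m' \<in> Q. \<forall>z \<in> mspace m \<inter> mspace m'.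
           \<exists>U. openin (mtopology_of m) U \<and> z \<in> U \<and> U \<subseteq> mspace m \<inter> mspace m' \<and>
             (\<forall>\<epsilon>>0. \<forall>x \<in> U. \<forall>y \<in> U. mdist m x y < \<delta> \<epsilon> \<longrightarrow> mdist m' x y < \<epsilon>)))"

definition quasi_local_equivalence :: "'b set \<Rightarrow> 'b metric set rel" where
  "quasi_local_equivalence Z =
     {(Q, Q'). quasi_locally_equal_cover Z Q \<and> quasi_locally_equal_cover Z Q' \<and>
               quasi_locally_equal_cover Z (Q \<union> Q')}"

definition quasi_local_metrics :: "'b set \<Rightarrow> 'b metric set set set" where
  "quasi_local_metrics Z = {Q. quasi_locally_equal_cover Z Q} // quasi_local_equivalence Z"

definition quasi_local_topology :: "'b metric set set \<Rightarrow> 'b topology" where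
  "quasi_local_topology \<QQ> =
     topology_generated_by {mball_of m x r |m x r. m \<in> \<Union>\<QQ> \<and> x \<in> mspace m \<and> r > 0}"

definition strongly_equicontinuous :: "'b topology \<Rightarrow> 'b rel set \<Rightarrow> bool" where
  "strongly_equicontinuous T H \<longleftrightarrow>
     pseudogroup T H \<and>
     (\<exists>\<QQ> \<in> quasi_local_metrics (topspace T). quasi_local_topology \<QQ> = T \<and>
       (\<exists>Q \<in> \<QQ>. \<exists>S.
          S \<subseteq> H \<and> generated_pseudogroup T S = H \<and>
          (\<forall>h \<in> S. h\<inverse> \<in> S) \<and> (\<forall>g \<in> S. \<forall>h \<in> S. g O h \<in> S) \<and>
          (\<forall>\<epsilon>>0. \<exists>\<delta>>0. \<forall>h \<in> S. \<forall>m \<in> Q. \<forall>m' \<in> Q. \<forall>x y x' y'.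
             (x, x') \<in> h \<and> (y, y') \<in> h \<and>
             x \<in> mspace m \<and> y \<in> mspace m \<and> x' \<in> mspace m' \<and> y' \<in> mspace m' \<and>
             mdist m x y < \<delta> \<longrightarrow> mdist m' x' y' < \<epsilon>)))"


section \<open>The holonomy pseudogroup\<close>

text \<open>
  \<open>Z\<^sub>c\<^sub>,\<^sub>d = p\<^sub>c (U\<^sub>c \<inter> U\<^sub>d)\<close>
\<close>

definition fb_overlap :: "('a, 'z) flow_box \<Rightarrow> ('a, 'z) flow_box \<Rightarrow> 'z set" where
  "fb_overlap c d = fb_proj c ` (fb_dom c \<inter> fb_dom d)"

text \<open>
  Regularity is exactly what is needed to define the holonomy pseudogroup: the existence of
  homeomorphisms \<open>h : Z\<^sub>c\<^sub>,\<^sub>d \<rightarrow> Z\<^sub>d\<^sub>,\<^sub>c\<close> with \<open>p\<^sub>d = h \<circ> p\<^sub>c\<close> on \<open>U\<^sub>c \<inter> U\<^sub>d\<close>. Every atlas that is regular in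
  one of the stricter senses in use satisfies this.
\<close>

definition regular_atlas :: "('a, 'z) flow_box set \<Rightarrow> bool" where
  "regular_atlas A \<longleftrightarrow>
     (\<forall>c \<in> A. \<forall>d \<in> A. \<exists>h.
        homeomorphic_map (subtopology (fb_trans c) (fb_overlap c d))
                         (subtopology (fb_trans d) (fb_overlap d c)) h \<and>
        (\<forall>x \<in> fb_dom c \<inter> fb_dom d. fb_proj d x = h (fb_proj c x)))"

definition holonomy_space ::
  "('a, 'z) flow_box set \<Rightarrow> (('a, 'z) flow_box \<times> 'z) topology" where
  "holonomy_space A = sum_topology fb_trans A"

text \<open>
  The graph of \<open>h\<^sub>c\<^sub>,\<^sub>d\<close>, viewed in the disjoint union of the transversals. For a regular atlas it is the
  graph of the homeomorphism \<open>h\<close> above, because \<open>p\<^sub>d = h \<circ> p\<^sub>c\<close> on \<open>U\<^sub>c \<inter> U\<^sub>d\<close>.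
\<close>

definition holonomy_map ::
  "('a, 'z) flow_box \<Rightarrow> ('a, 'z) flow_box \<Rightarrow> (('a, 'z) flow_box \<times> 'z) rel" where
  "holonomy_map c d = {((c, fb_proj c x), (d, fb_proj d x)) |x. x \<in> fb_dom c \<inter> fb_dom d}"

definition holonomy_pseudogroup ::
  "('a, 'z) flow_box set \<Rightarrow> (('a, 'z) flow_box \<times> 'z) rel set" where
  "holonomy_pseudogroup A =
     generated_pseudogroup (holonomy_space A) {holonomy_map c d |c d. c \<in> A \<and> d \<in> A}"

text \<open>
  The holonomy pseudogroup is represented through an arbitrary regular atlas \<open>A'\<close> of the same
  foliated structure, that is, one whose union with \<open>A\<close> is again a foliated atlas.
\<close>

definition strongly_equicontinuous_foliated_space ::
  "nat \<Rightarrow> enat \<Rightarrow> 'a topology \<Rightarrow> ('a, 'z) flow_box set \<Rightarrow> bool" where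
  "strongly_equicontinuous_foliated_space n k X A \<longleftrightarrow>
     (\<exists>A'. foliated_space n k X A' \<and> foliated_space n k X (A \<union> A') \<and> regular_atlas A' \<and>
        strongly_equicontinuous (holonomy_space A') (holonomy_pseudogroup A'))"

end

(*
  The closure of a leaf is saturated, so everything reduces to symmetry: if y lies in the closure of
  the leaf of x, then x lies in the closure of the leaf of y. Join a point x' of the leaf of x near y
  to x by a chain of small plaques in finitely many open sets with closures inside flow boxes. By
  compactness every box change at a point of the chain is realised, on a transverse ball of uniform
  radius, by an element of the composition-closed generating set S. Hence the chain can be followed
  starting from y instead of x', as long as the transverse distance stays below that radius; and it
  does, since the composite of all the box changes so far belongs to S, to which the equicontinuity
  estimate applies with a delta independent of the length of the chain.
*)
theory Submission
  imports Defs
begin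

section \<open>Metric preliminaries\<close>

text \<open>Strong equicontinuity says nothing about domains: it compares two images only where the
  composite is already defined at both points. This is why the chain is followed one box change at a
  time. Each change provides the new image of the second point within \<rho>, a crude bound that
  puts both images into a common space of the quasi-local metric; only then does the estimate for
  the composite apply. The metrics of the quasi-local family agree only on neighbourhoods of
  uncontrolled size. All distances are therefore taken in one auxiliary metric \<open>d\<close> on
  the disjoint union of the transversals, and Lebesgue numbers over a fixed compact set convert
  between \<open>d\<close> and the family. The projections of the chain stay in that compact set;
  those of the followed points need not. Leaves belong to the given atlas \<open>A\<close>, the
  pseudogroup to a possibly different atlas \<open>A'\<close>, so plaques of \<open>A'\<close> have
  to be recognised as pieces of leaves of \<open>A\<close>.\<close>

lemma mdist_self: "x \<in> mspace m \<Longrightarrow> mdist m x x = 0"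
  by simp

lemma quasi_locally_equal_cover_ball_subset:
  assumes "quasi_locally_equal_cover Z Q" "m \<in> Q" "m' \<in> Q"
    and "z \<in> mspace m" "z \<in> mspace m'" "\<epsilon> > 0"
  obtains r where "r > 0" "mball_of m z r \<subseteq> mball_of m' z \<epsilon>"
proof -
  obtain \<delta> :: "real \<Rightarrow> real" where \<delta>: "\<forall>\<epsilon>>0. \<delta> \<epsilon> > 0"
    and "\<forall>m \<in> Q. \<forall>m' \<in> Q. \<forall>z \<in> mspace m \<inter> mspace m'.
           \<exists>U. openin (mtopology_of m) U \<and> z \<in> U \<and> U \<subseteq> mspace m \<inter> mspace m' \<and>
             (\<forall>\<epsilon>>0. \<forall>x \<in> U. \<forall>y \<in> U. mdist m x y < \<delta> \<epsilon> \<longrightarrow> mdist m' x y < \<epsilon>)"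
    using assms(1) unfolding quasi_locally_equal_cover_def by blast
  then obtain U where U: "openin (mtopology_of m) U" "z \<in> U" "U \<subseteq> mspace m \<inter> mspace m'"
    "\<And>\<epsilon> x y. \<epsilon> > 0 \<Longrightarrow> x \<in> U \<Longrightarrow> y \<in> U \<Longrightarrow> mdist m x y < \<delta> \<epsilon> \<Longrightarrow> mdist m' x y < \<epsilon>"
    using assms by (metis IntI)
  obtain r where r: "r > 0" "mball_of m z r \<subseteq> U"
    using U(1,2) Metric_space.openin_mtopology[OF Metric_space_mspace_mdist, of m U]
    unfolding mtopology_of_def mball_of_def by blast
  have "mball_of m z (min r (\<delta> \<epsilon>)) \<subseteq> mball_of m' z \<epsilon>"
  proof
    fix y assume y: "y \<in> mball_of m z (min r (\<delta> \<epsilon>))"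
    then have "y \<in> U" using r(2) by (auto simp: subset_iff)
    then show "y \<in> mball_of m' z \<epsilon>"
      using U(2,3) U(4)[OF \<open>\<epsilon> > 0\<close> \<open>z \<in> U\<close>, of y] y by auto
  qed
  then show ?thesis
    using that[of "min r (\<delta> \<epsilon>)"] r(1) \<delta> \<open>\<epsilon> > 0\<close> by auto
qed

section \<open>The topology of a quasi-local metric\<close>

lemma quasi_local_metrics_cover:
  assumes "\<QQ> \<in> quasi_local_metrics Z" "Q \<in> \<QQ>"
  shows "quasi_locally_equal_cover Z Q"
  using assms unfolding quasi_local_metrics_def quasi_local_equivalence_def
  by (auto simp: quotient_def)

lemma openin_mball_quasi_local_topology:
  assumes "m \<in> \<Union>\<QQ>" "x \<in> mspace m" "r > 0"
  shows "openin (quasi_local_topology \<QQ>) (mball_of m x r)"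
  unfolding quasi_local_topology_def using assms by (intro topology_generated_by_Basis) blast

lemma openin_mspace_quasi_local_topology:
  assumes "m \<in> \<Union>\<QQ>"
  shows "openin (quasi_local_topology \<QQ>) (mspace m)"
proof (subst openin_subopen, intro ballI)
  fix x assume "x \<in> mspace m"
  then show "\<exists>T. openin (quasi_local_topology \<QQ>) T \<and> x \<in> T \<and> T \<subseteq> mspace m"
    using openin_mball_quasi_local_topology[OF assms, of x 1]
    by (intro exI[of _ "mball_of m x 1"]) (auto simp: mdist_self)
qed

text \<open>Two metrics \<open>m\<close> and \<open>m'\<close> of the class may come from different
  families, and membership in the class directly relates each family only to the representative
  \<open>Q0\<close>. Their balls are therefore compared through a metric \<open>m0\<close> of
  \<open>Q0\<close> at \<open>z\<close>.\<close>

lemma openin_quasi_local_topology_contains_mball: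
  assumes QQ: "\<QQ> \<in> quasi_local_metrics Z" and m: "m \<in> \<Union>\<QQ>"
    and W: "openin (quasi_local_topology \<QQ>) W" and z: "z \<in> W" "z \<in> mspace m"
  obtains r where "r > 0" "mball_of m z r \<subseteq> W"
proof -
  obtain Q0 where Q0: "quasi_locally_equal_cover Z Q0" "\<QQ> = quasi_local_equivalence Z `` {Q0}"
    using QQ unfolding quasi_local_metrics_def by (auto simp: quotient_def)
  have cov: "quasi_locally_equal_cover Z (Q0 \<union> Q)" if "Q \<in> \<QQ>" for Q
    using that Q0(2) by (auto simp: quasi_local_equivalence_def)
  obtain Q where Q: "Q \<in> \<QQ>" "m \<in> Q" using m by blast
  have "z \<in> Z"
    using quasi_local_metrics_cover[OF QQ Q(1)] Q(2) z(2)
    unfolding quasi_locally_equal_cover_def by blast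
  then obtain m0 where m0: "m0 \<in> Q0" "z \<in> mspace m0"
    using Q0(1) unfolding quasi_locally_equal_cover_def by blast
  have "generate_topology_on {mball_of m x r |m x r. m \<in> \<Union>\<QQ> \<and> x \<in> mspace m \<and> r > 0} W"
    using W unfolding quasi_local_topology_def by (rule openin_topology_generated_by)
  then have "\<exists>r>0. mball_of m z r \<subseteq> W"
    using z(1)
  proof induction
    case (Int a b)
    then obtain r s where "r > 0" "mball_of m z r \<subseteq> a" "s > 0" "mball_of m z s \<subseteq> b" by auto
    then show ?case by (intro exI[of _ "min r s"]) (auto simp: subset_iff)
  next
    case (Basis s)
    then obtain m' x r Q' where s: "s = mball_of m' x r" "m' \<in> Q'" "Q' \<in> \<QQ>" "x \<in> mspace m'" "r > 0"
      by blast
    have zm': "z \<in> mspace m'" "mdist m' x z < r" using s(1) Basis.prems by auto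
    have "mball_of m' z (r - mdist m' x z) \<subseteq> s"
    proof
      fix u assume "u \<in> mball_of m' z (r - mdist m' x z)"
      then show "u \<in> s" using s(4) zm' mdist_triangle[of x m' z u] by (auto simp: s(1))
    qed
    moreover obtain r' where r': "r' > 0" "mball_of m0 z r' \<subseteq> mball_of m' z (r - mdist m' x z)"
      using quasi_locally_equal_cover_ball_subset[OF cov[OF s(3)], of m0 m' z "r - mdist m' x z"]
        s(2) m0 zm' by auto
    moreover obtain r'' where "r'' > 0" "mball_of m z r'' \<subseteq> mball_of m0 z r'"
      using quasi_locally_equal_cover_ball_subset[OF cov[OF Q(1)], of m m0 z r'] Q(2) m0 z(2) r'(1)
      by auto
    ultimately show ?case by blast
  qed (auto, metis UnionI subset_trans Union_upper)
  then show ?thesis using that by blast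
qed

section \<open>Disjoint unions of metrizable spaces\<close>

lemma metrizable_space_sum_topology:
  assumes "\<And>i. i \<in> I \<Longrightarrow> metrizable_space (X i)"
  shows "metrizable_space (sum_topology X I)"
proof -
  have "\<forall>i\<in>I. \<exists>m. X i = mtopology_of m"
    using assms unfolding metrizable_space_def by (metis Metric_space.mtopology_of)
  then obtain m where m: "\<And>i. i \<in> I \<Longrightarrow> X i = mtopology_of (m i)" by metis
  have sp: "i \<in> I \<Longrightarrow> mspace (m i) = topspace (X i)" for i by (simp add: m)
  define M where "M = Sigma I (topspace \<circ> X)"
  \<comment> \<open>With the truncation at 1, the triangle inequality survives a middle point in
    another summand. An open ball of radius at most 1 stays in one summand, whence
    \<open>min r 1\<close> below.\<close>
  define d where "d = (\<lambda>p q. if fst p = fst q then min 1 (mdist (m (fst p)) (snd p) (snd q)) else (1::real))"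
  have M: "Metric_space M d"
  proof
    show "0 \<le> d x y" for x y by (simp add: d_def)
    show "d x y = d y x" for x y by (simp add: d_def mdist_commute)
    show "(d x y = 0) = (x = y)" if "x \<in> M" "y \<in> M" for x y
      using that unfolding M_def by (auto simp: d_def min_def sp mdist_self split: if_splits)
    show "d x z \<le> d x y + d y z" if "x \<in> M" "y \<in> M" "z \<in> M" for x y z
    proof (cases "fst x = fst y \<and> fst y = fst z")
      case True
      have "mdist (m (fst x)) (snd x) (snd z) \<le>
          mdist (m (fst x)) (snd x) (snd y) + mdist (m (fst x)) (snd y) (snd z)"
        using that True unfolding M_def by (intro mdist_triangle) (auto simp: sp)
      moreover have "mdist (m (fst x)) (snd x) (snd y) \<ge> 0" "mdist (m (fst x)) (snd y) (snd z) \<ge> 0"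
        by auto
      moreover have "min 1 c \<le> min 1 a + min 1 b" if "c \<le> a + b" "0 \<le> a" "0 \<le> b" for a b c :: real
        using that by auto
      ultimately show ?thesis using True unfolding d_def by simp
    qed (auto simp: d_def)
  qed
  then interpret Metric_space M d .
  have "openin mtopology U \<longleftrightarrow> openin (sum_topology X I) U" for U
  proof
    assume U: "openin mtopology U"
    have "openin (X i) {x. (i, x) \<in> U}" if i: "i \<in> I" for i
      unfolding m[OF i] mtopology_of_def Metric_space.openin_mtopology[OF Metric_space_mspace_mdist]
    proof (intro conjI allI impI)
      show "{x. (i, x) \<in> U} \<subseteq> mspace (m i)"
        using U i unfolding openin_mtopology by (auto simp: M_def sp)
      fix x assume "x \<in> {x. (i, x) \<in> U}"
      then obtain r where r: "r > 0" "mball (i, x) r \<subseteq> U" and ix: "(i,x) \<in> M"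
        using U unfolding openin_mtopology by blast
      have "Metric_space.mball (mspace (m i)) (mdist (m i)) x (min r 1) \<subseteq> {x. (i, x) \<in> U}"
      proof (clarsimp simp: Metric_space.in_mball)
        fix y assume "y \<in> mspace (m i)" "mdist (m i) x y < r" "mdist (m i) x y < 1"
        then have "(i, y) \<in> M" "d (i, x) (i, y) < r"
          using i by (simp_all add: M_def sp d_def)
        then have "(i, y) \<in> mball (i, x) r"
          using ix by simp
        then show "(i, y) \<in> U" using r by blast
      qed
      then show "\<exists>r>0. Metric_space.mball (mspace (m i)) (mdist (m i)) x r \<subseteq> {x. (i, x) \<in> U}"
        using r by (intro exI[of _ "min r 1"]) auto
    qed
    then show "openin (sum_topology X I) U"
      using U unfolding openin_mtopology by (simp add: openin_sum_topology M_def)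
  next
    assume U: "openin (sum_topology X I) U"
    show "openin mtopology U"
      unfolding openin_mtopology
    proof (intro conjI allI impI)
      show "U \<subseteq> M" using U by (simp add: openin_sum_topology M_def)
      fix p assume p: "p \<in> U"
      obtain i x where ix: "p = (i, x)" "i \<in> I" "x \<in> topspace (X i)"
        using \<open>U \<subseteq> M\<close> p by (auto simp: M_def)
      have "openin (X i) {x. (i, x) \<in> U}" using U ix by (simp add: openin_sum_topology)
      then obtain r where r: "r > 0" "mball_of (m i) x r \<subseteq> {x. (i, x) \<in> U}"
        using p ix unfolding m[OF ix(2)] mtopology_of_def mball_of_def
          Metric_space.openin_mtopology[OF Metric_space_mspace_mdist] by blast
      have "mball p (min r 1) \<subseteq> U"
      proof
        fix q assume "q \<in> mball p (min r 1)"
        then have "q \<in> M" "d p q < r" "d p q < 1" by auto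
        then have q: "fst q = i" "mdist (m i) x (snd q) < r" "snd q \<in> topspace (X i)"
          using ix by (auto simp: d_def M_def split: if_splits)
        then have "snd q \<in> mball_of (m i) x r" using ix by (simp add: sp)
        then show "q \<in> U" using r q(1) by (metis mem_Collect_eq prod.collapse subsetD)
      qed
      then show "\<exists>r>0. mball p r \<subseteq> U" using r by (intro exI[of _ "min r 1"]) auto
    qed
  qed
  then have "sum_topology X I = mtopology" by (simp add: topology_eq)
  then show ?thesis using metrizable_space_mtopology by simp
qed

section \<open>Germs and equicontinuity of pseudogroups\<close>

lemma local_transformation_unique:
  "local_transformation T h \<Longrightarrow> (x, y) \<in> h \<Longrightarrow> (x, y') \<in> h \<Longrightarrow> y' = y"
  unfolding local_transformation_def by auto

lemma local_transformation_subset_topspace: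
  assumes "local_transformation T h"
  shows "h \<subseteq> topspace T \<times> topspace T"
proof -
  obtain U V f where *: "openin T U" "openin T V" "h = {(x, f x) |x. x \<in> U}"
    and hom: "homeomorphic_map (subtopology T U) (subtopology T V) f"
    using assms unfolding local_transformation_def by blast
  have "f ` U \<subseteq> V"
    using homeomorphic_imp_surjective_map[OF hom] *
    by (metis openin_subset subset_refl topspace_subtopology_subset)
  then show ?thesis
    using openin_subset[OF *(1)] openin_subset[OF *(2)] by (auto simp: *(3))
qed

lemma local_transformation_continuous:
  assumes "local_transformation T h" "(x, y) \<in> h" "openin T V" "y \<in> V"
  obtains W where "openin T W" "x \<in> W" "\<And>w. w \<in> W \<Longrightarrow> \<exists>w'\<in>V. (w, w') \<in> h"
proof -
  obtain U U' f where *: "openin T U" "openin T U'" "h = {(x, f x) |x. x \<in> U}"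
    and hom: "homeomorphic_map (subtopology T U) (subtopology T U') f"
    using assms unfolding local_transformation_def by blast
  have "continuous_map (subtopology T U) T f"
    using homeomorphic_imp_continuous_map[OF hom] by (simp add: continuous_map_in_subtopology)
  then have "openin (subtopology T U) {x \<in> topspace (subtopology T U). f x \<in> V}"
    using assms(3) by (rule openin_continuous_map_preimage)
  moreover have "{x \<in> topspace (subtopology T U). f x \<in> V} = {x \<in> U. f x \<in> V}"
    using openin_subset[OF *(1)] by auto
  ultimately have "openin T {x \<in> U. f x \<in> V}"
    using *(1) openin_trans_full by metis
  then show ?thesis
  proof (rule that)
    show "x \<in> {x \<in> U. f x \<in> V}" using assms(2,4) *(3) by auto
    show "\<exists>w'\<in>V. (w, w') \<in> h" if "w \<in> {x \<in> U. f x \<in> V}" for w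
      using that by (intro bexI[of _ "f w"]) (auto simp: *(3))
  qed
qed

lemma pseudogroupD:
  assumes "pseudogroup T H"
  shows "h \<in> H \<Longrightarrow> local_transformation T h" "Id_on (topspace T) \<in> H"
  using assms unfolding pseudogroup_def by simp_all

text \<open>Equicontinuity is given for \<open>S\<close> alone, whereas box changes are elements of
  the generated pseudogroup. Restrictions and unions do not alter germs, and \<open>S\<close> is
  closed under the other operations. Inclusion of \<open>s\<close> in \<open>g\<close> over
  \<open>W\<close> is enough: as \<open>s\<close> contains \<open>(z, z')\<close>, it is defined
  near \<open>z\<close> anyway.\<close>

lemma generated_pseudogroup_germ:
  assumes H: "pseudogroup T H" "S \<subseteq> H"
    and inv: "\<And>s. s \<in> S \<Longrightarrow> s\<inverse> \<in> S" and comp: "\<And>s s'. s \<in> S \<Longrightarrow> s' \<in> S \<Longrightarrow> s O s' \<in> S"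
    and id: "Id_on (topspace T) \<in> S"
    and g: "g \<in> generated_pseudogroup T S" "(z, z') \<in> g"
  shows "\<exists>s\<in>S. \<exists>W. (z, z') \<in> s \<and> openin T W \<and> z \<in> W \<and> (\<forall>w\<in>W. \<forall>w'. (w, w') \<in> s \<longrightarrow> (w, w') \<in> g)"
proof -
  have lt: "local_transformation T s" if "s \<in> S" for s
    using that H(2) pseudogroupD(1)[OF H(1)] by (meson subsetD)
  show ?thesis
    using g
  proof (induction arbitrary: z z')
    case (gen_base h)
    then show ?case
      using local_transformation_subset_topspace[OF lt[of h]]
      by (intro bexI[of _ h] exI[of _ "topspace T"]) auto
  next
    case gen_id
    then show ?case
      by (intro bexI[of _ "Id_on (topspace T)"] exI[of _ "topspace T"]) (use id in auto)
  next
    case (gen_comp g h)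
    then obtain y where y: "(z, y) \<in> g" "(y, z') \<in> h" by blast
    obtain s1 W1 where 1: "s1 \<in> S" "(z, y) \<in> s1" "openin T W1" "z \<in> W1"
      "\<forall>w\<in>W1. \<forall>w'. (w, w') \<in> s1 \<longrightarrow> (w, w') \<in> g"
      using gen_comp.IH(1)[OF y(1)] by blast
    obtain s2 W2 where 2: "s2 \<in> S" "(y, z') \<in> s2" "openin T W2" "y \<in> W2"
      "\<forall>w\<in>W2. \<forall>w'. (w, w') \<in> s2 \<longrightarrow> (w, w') \<in> h"
      using gen_comp.IH(2)[OF y(2)] by blast
    obtain W where W: "openin T W" "z \<in> W" "\<And>w. w \<in> W \<Longrightarrow> \<exists>w'\<in>W2. (w, w') \<in> s1"
      using local_transformation_continuous[OF lt[OF 1(1)] 1(2) 2(3,4)] by blast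
    have "(w, w') \<in> g O h" if w: "w \<in> W1 \<inter> W" "(w, w') \<in> s1 O s2" for w w'
    proof -
      obtain v where v: "(w, v) \<in> s1" "(v, w') \<in> s2" using w(2) by blast
      have "v \<in> W2"
        using W(3)[of w] w(1) v(1) local_transformation_unique[OF lt[OF 1(1)]] by blast
      then show ?thesis using v w(1) 1(5) 2(5) by blast
    qed
    then show ?case
      using comp[OF 1(1) 2(1)] 1 2 W
      by (intro bexI[of _ "s1 O s2"] exI[of _ "W1 \<inter> W"]) auto
  next
    case (gen_inv h)
    then have "(z', z) \<in> h" by simp
    then obtain s W where s: "s \<in> S" "(z', z) \<in> s" "openin T W" "z' \<in> W"
      "\<forall>w\<in>W. \<forall>w'. (w, w') \<in> s \<longrightarrow> (w, w') \<in> h"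
      using gen_inv.IH by blast
    have s': "s\<inverse> \<in> S" "(z, z') \<in> s\<inverse>" using s inv by auto
    \<comment> \<open>\<open>W\<close> is a neighbourhood of \<open>z'\<close>; continuity of the
      inverse of \<open>s\<close> pulls it back to one of \<open>z\<close>.\<close>
    obtain W' where W: "openin T W'" "z \<in> W'" "\<And>w. w \<in> W' \<Longrightarrow> \<exists>w'\<in>W. (w, w') \<in> s\<inverse>"
      using local_transformation_continuous[OF lt[OF s'(1)] s'(2) s(3,4)] by blast
    have "(w, w') \<in> h\<inverse>" if w: "w \<in> W'" "(w, w') \<in> s\<inverse>" for w w'
      using W(3)[OF w(1)] w(2) local_transformation_unique[OF lt[OF s'(1)]] s(5) by blast
    then show ?case using s' W by blast
  next
    case (gen_restrict h W')
    then have "(z, z') \<in> h" "z \<in> W'" by auto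
    then obtain s W where "s \<in> S" "(z, z') \<in> s" "openin T W" "z \<in> W"
      "\<forall>w\<in>W. \<forall>w'. (w, w') \<in> s \<longrightarrow> (w, w') \<in> h"
      using gen_restrict.IH by blast
    then show ?case
      using \<open>z \<in> W'\<close> \<open>openin T W'\<close> by (intro bexI[of _ s] exI[of _ "W \<inter> W'"]) auto
  next
    case (gen_union F)
    then obtain h where h: "h \<in> F" "(z, z') \<in> h" by blast
    show ?case using gen_union.IH[OF h] h(1) by blast
  qed
qed

text \<open>
  Strong equicontinuity only compares \<open>z'\<close> and \<open>w'\<close> if they lie in a common space of the quasi-local
  metric. On a compact set this is ensured by \<open>d z' w' < \<rho>\<close>, where \<open>\<rho>\<close> does not depend on \<open>\<epsilon>\<close>.
\<close>

lemma (in Metric_space) strongly_equicontinuousE: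
  assumes se: "strongly_equicontinuous mtopology H"
  obtains S where "S \<subseteq> H" "Id_on M \<in> S" "\<forall>s\<in>S. \<forall>s'\<in>S. s O s' \<in> S"
    "\<forall>g\<in>H. \<forall>z z'. (z, z') \<in> g \<longrightarrow> (\<exists>s\<in>S. \<exists>W. (z, z') \<in> s \<and> openin mtopology W \<and> z \<in> W \<and>
        (\<forall>w\<in>W. \<forall>w'. (w, w') \<in> s \<longrightarrow> (w, w') \<in> g))"
    "\<forall>C. compactin mtopology C \<longrightarrow> (\<exists>\<rho>>0. \<forall>\<epsilon>>0. \<exists>\<delta>>0. \<forall>s\<in>S. \<forall>z\<in>C. \<forall>z'\<in>C. \<forall>w w'.
        (z, z') \<in> s \<longrightarrow> (w, w') \<in> s \<longrightarrow> d z w < \<delta> \<longrightarrow> d z' w' < \<rho> \<longrightarrow> d z' w' < \<epsilon>)"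
proof -
  obtain \<QQ> Q S where H: "pseudogroup mtopology H"
    and QQ: "\<QQ> \<in> quasi_local_metrics M" "quasi_local_topology \<QQ> = mtopology" "Q \<in> \<QQ>"
    and S: "S \<subseteq> H" "generated_pseudogroup mtopology S = H" "\<forall>h \<in> S. h\<inverse> \<in> S" "\<forall>g \<in> S. \<forall>h \<in> S. g O h \<in> S"
    and eq: "\<forall>\<epsilon>>0. \<exists>\<delta>>0. \<forall>h \<in> S. \<forall>m \<in> Q. \<forall>m' \<in> Q. \<forall>x y x' y'.
             (x, x') \<in> h \<and> (y, y') \<in> h \<and>
             x \<in> mspace m \<and> y \<in> mspace m \<and> x' \<in> mspace m' \<and> y' \<in> mspace m' \<and>
             mdist m x y < \<delta> \<longrightarrow> mdist m' x' y' < \<epsilon>"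
    using se unfolding strongly_equicontinuous_def topspace_mtopology
    by (elim conjE bexE exE) (rule that; assumption)
  \<comment> \<open>The identity need not belong to \<open>S\<close>, and a quasi-local metric gives no uniform estimate between
      two of its metrics for it; it satisfies the estimate below because only \<open>d\<close> occurs there.\<close>
  define S' where "S' = insert (Id_on M) S"
  have S'H: "S' \<subseteq> H"
    using pseudogroupD(2)[OF H] S(1) unfolding S'_def topspace_mtopology by simp
  have sub: "s \<subseteq> M \<times> M" if "s \<in> S'" for s
    using local_transformation_subset_topspace[OF pseudogroupD(1)[OF H]] that S'H
    by (metis subsetD topspace_mtopology)
  have neutral: "Id_on M O s = s" "s O Id_on M = s" if "s \<in> S'" for s
    using sub[OF that] by auto
  have comp: "s O s' \<in> S'" if "s \<in> S'" "s' \<in> S'" for s s'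
    using that neutral[of s] neutral[of s'] S(4) unfolding S'_def by auto
  have gen: "g \<in> generated_pseudogroup mtopology S'" if "g \<in> H" for g
    using that unfolding S(2)[symmetric]
    by (induction rule: generated_pseudogroup.induct)
      (auto simp: S'_def intro: generated_pseudogroup.intros)
  have cover: "quasi_locally_equal_cover M Q" using quasi_local_metrics_cover QQ by blast
  have openm: "openin mtopology (mspace m)" if "m \<in> Q" for m
    using openin_mspace_quasi_local_topology[of m \<QQ>] that QQ by auto
  have openball: "openin mtopology (mball_of m x r)" if "m \<in> Q" "x \<in> mspace m" "r > 0" for m x r
    using openin_mball_quasi_local_topology[of m \<QQ>] that QQ by auto
  have equi: "\<exists>\<rho>>0. \<forall>\<epsilon>>0. \<exists>\<delta>>0. \<forall>s\<in>S'. \<forall>z\<in>C. \<forall>z'\<in>C. \<forall>w w'.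
        (z, z') \<in> s \<longrightarrow> (w, w') \<in> s \<longrightarrow> d z w < \<delta> \<longrightarrow> d z' w' < \<rho> \<longrightarrow> d z' w' < \<epsilon>"
    if C: "compactin mtopology C" for C
  proof -
    have CM: "C \<subseteq> M" using C compactin_subset_topspace by force
    have "C \<subseteq> \<Union>(mspace ` Q)"
      using CM cover unfolding quasi_locally_equal_cover_def by blast
    \<comment> \<open>A Lebesgue number for the cover of \<open>C\<close> by the underlying sets of
      the metrics; it is fixed before \<epsilon>, as the order of quantifiers demands.\<close>
    then obtain \<rho>0 where \<rho>0: "\<rho>0 > 0" "\<forall>x\<in>C. \<exists>U\<in>mspace ` Q. mball x \<rho>0 \<subseteq> U"
      using lebesgue_number[OF C, of "mspace ` Q"] openm by blast
    then have "\<forall>t\<in>C. \<exists>m. m \<in> Q \<and> mball t \<rho>0 \<subseteq> mspace m" by blast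
    then obtain \<mu> where \<mu>: "\<And>t. t \<in> C \<Longrightarrow> \<mu> t \<in> Q" "\<And>t. t \<in> C \<Longrightarrow> mball t \<rho>0 \<subseteq> mspace (\<mu> t)"
      by metis
    have t\<mu>: "t \<in> mspace (\<mu> t)" if "t \<in> C" for t
      using \<mu>(2)[OF that] that CM \<rho>0(1) by auto
    have "\<exists>\<delta>>0. \<forall>s\<in>S'. \<forall>z\<in>C. \<forall>z'\<in>C. \<forall>w w'.
        (z, z') \<in> s \<longrightarrow> (w, w') \<in> s \<longrightarrow> d z w < \<delta> \<longrightarrow> d z' w' < \<rho>0/2 \<longrightarrow> d z' w' < \<epsilon>"
      if \<epsilon>: "\<epsilon> > 0" for \<epsilon>
    proof -
      \<comment> \<open>The metric \<open>\<mu> t\<close> is converted to \<open>d\<close> at the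
        centre \<open>t\<close> only, with a radius depending on \<open>t\<close>. Hence the finite
        set \<open>F\<close> of centres, and the comparison of both \<open>z'\<close> and
        \<open>w'\<close> with \<open>t\<close>.\<close>
      have "\<exists>r>0. mball_of (\<mu> t) t r \<subseteq> mball t (\<epsilon>/2)" if t: "t \<in> C" for t
      proof -
        have "\<mu> t \<in> \<Union>\<QQ>" "t \<in> mball t (\<epsilon>/2)"
          using \<mu>(1)[OF t] QQ(3) CM t \<epsilon> by auto
        then show ?thesis
          using openin_quasi_local_topology_contains_mball[OF QQ(1), of "\<mu> t" "mball t (\<epsilon>/2)" t]
            t\<mu>[OF t] openin_mball[of t "\<epsilon>/2"] unfolding QQ(2) by metis
      qed
      then obtain r where r: "\<And>t. t \<in> C \<Longrightarrow> r t > 0"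
        "\<And>t. t \<in> C \<Longrightarrow> mball_of (\<mu> t) t (r t) \<subseteq> mball t (\<epsilon>/2)" by metis
      define V where "V = (\<lambda>t. mball t (\<rho>0/2) \<inter> mball_of (\<mu> t) t (r t / 2))"
      have oV: "openin mtopology (V t)" if "t \<in> C" for t
        unfolding V_def using that \<mu> t\<mu> r by (intro openin_Int openball) auto
      have "C \<subseteq> \<Union>(V ` C)"
        using CM \<rho>0(1) r(1) t\<mu> by (auto simp: V_def mdist_self)
      then obtain F where F: "finite F" "F \<subseteq> C" "C \<subseteq> \<Union>(V ` F)"
      proof -
        obtain \<F> where "finite \<F>" "\<F> \<subseteq> V ` C" "C \<subseteq> \<Union>\<F>"
          using compactinD[OF C, of "V ` C"] oV \<open>C \<subseteq> \<Union>(V ` C)\<close> by blast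
        then show ?thesis using that finite_subset_image[of \<F> V C] by blast
      qed
      \<comment> \<open>The entry 1 covers the case of empty \<open>F\<close>.\<close>
      define \<epsilon>' where "\<epsilon>' = Min (insert 1 ((\<lambda>t. r t / 2) ` F))"
      have "\<epsilon>' \<le> r t / 2" if "t \<in> F" for t
        unfolding \<epsilon>'_def using F(1) that by (intro Min_le) auto
      moreover have "\<epsilon>' > 0"
        unfolding \<epsilon>'_def using F r(1) by auto
      ultimately have \<epsilon>': "\<epsilon>' > 0" "\<And>t. t \<in> F \<Longrightarrow> \<epsilon>' \<le> r t / 2"
        by auto
      obtain \<delta>' where \<delta>': "\<delta>' > 0" "\<And>h m m' x y x' y'. h \<in> S \<Longrightarrow> m \<in> Q \<Longrightarrow> m' \<in> Q \<Longrightarrow>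
          (x, x') \<in> h \<Longrightarrow> (y, y') \<in> h \<Longrightarrow> x \<in> mspace m \<Longrightarrow> y \<in> mspace m \<Longrightarrow> x' \<in> mspace m' \<Longrightarrow>
          y' \<in> mspace m' \<Longrightarrow> mdist m x y < \<delta>' \<Longrightarrow> mdist m' x' y' < \<epsilon>'"
        using eq \<epsilon>'(1) by meson
      \<comment> \<open>Conversion at the source: a Lebesgue number for these balls puts points that
        are close in \<open>d\<close> into one ball of radius \<open>\<delta>'/2\<close>, hence
        within \<open>\<delta>'\<close> in a single metric of \<open>Q\<close>.\<close>
      let ?B = "{mball_of m x (\<delta>'/2) |m x. m \<in> Q \<and> x \<in> mspace m}"
      have "C \<subseteq> \<Union>?B"
      proof
        fix t assume "t \<in> C"
        then have "t \<in> mball_of (\<mu> t) t (\<delta>'/2)" using t\<mu> \<delta>'(1) by (simp add: mdist_self)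
        then show "t \<in> \<Union>?B" using \<mu>(1)[OF \<open>t \<in> C\<close>] t\<mu>[OF \<open>t \<in> C\<close>] by blast
      qed
      moreover have "openin mtopology U" if "U \<in> ?B" for U
        using that openball \<delta>'(1) by auto
      ultimately obtain \<delta>1 where \<delta>1: "\<delta>1 > 0" "\<forall>x\<in>C. \<exists>U\<in>?B. mball x \<delta>1 \<subseteq> U"
        using lebesgue_number[OF C, of ?B] by blast
      \<comment> \<open>The bound \<epsilon> on \<open>d z w\<close> serves the identity, which
        preserves \<open>d\<close>; all other elements use \<open>\<delta>1\<close>.\<close>
      have "d z' w' < \<epsilon>" if s: "s \<in> S'" and z: "z \<in> C" "z' \<in> C" "(z, z') \<in> s" and w: "(w, w') \<in> s"
        and dw: "d z w < min \<delta>1 \<epsilon>" and dw': "d z' w' < \<rho>0/2" for s z z' w w'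
      proof (cases "s = Id_on M")
        case True
        then show ?thesis using z w dw by auto
      next
        case False
        then have "s \<in> S" using s by (simp add: S'_def)
        have M: "z \<in> M" "z' \<in> M" "w \<in> M" "w' \<in> M" using sub[OF s] z w by auto
        obtain m x where m: "m \<in> Q" "x \<in> mspace m" "mball z \<delta>1 \<subseteq> mball_of m x (\<delta>'/2)"
          using \<delta>1(2) z(1) by blast
        have "z \<in> mball_of m x (\<delta>'/2)" "w \<in> mball_of m x (\<delta>'/2)"
          using m(3) M dw \<delta>1(1) by auto
        then have zw: "z \<in> mspace m" "w \<in> mspace m" "mdist m z w < \<delta>'"
          using mdist_triangle[of z m x w] mdist_commute[of m x z] by auto
        obtain t where t: "t \<in> F" "z' \<in> V t" using F(3) z(2) by blast
        have tC: "t \<in> C" "t \<in> M" using t F CM by auto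
        have tz: "d t z' < \<rho>0/2" "z' \<in> mspace (\<mu> t)" "mdist (\<mu> t) t z' < r t / 2"
          using t(2) by (auto simp: V_def)
        \<comment> \<open>Here the a priori bound on \<open>d z' w'\<close> enters: it places
          \<open>w'\<close> in the space of \<open>\<mu> t\<close>, so that the estimate for
          \<open>S\<close> applies.\<close>
        have "d t w' < \<rho>0" using triangle[of t z' w'] tz(1) dw' M tC by linarith
        then have w'm: "w' \<in> mspace (\<mu> t)" using \<mu>(2)[OF tC(1)] M tC by auto
        have "mdist (\<mu> t) z' w' < r t / 2"
          using \<delta>'(2)[OF \<open>s \<in> S\<close> m(1) \<mu>(1)[OF tC(1)] z(3) w zw(1,2) tz(2) w'm zw(3)] \<epsilon>'(2)[OF t(1)]
          by linarith
        then have "mdist (\<mu> t) t w' < r t"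
          using mdist_triangle[of t "\<mu> t" z' w'] tz t\<mu>[OF tC(1)] w'm by linarith
        then have "w' \<in> mball t (\<epsilon>/2)" using r(2)[OF tC(1)] t\<mu>[OF tC(1)] w'm by auto
        moreover have "mdist (\<mu> t) t z' < r t" using tz r(1)[OF tC(1)] by linarith
        then have "z' \<in> mball t (\<epsilon>/2)" using r(2)[OF tC(1)] t\<mu>[OF tC(1)] tz by auto
        ultimately show ?thesis
          using triangle[of z' t w'] commute[of z' t] by auto
      qed
      then show ?thesis
        using \<delta>1(1) \<epsilon> by (intro exI[of _ "min \<delta>1 \<epsilon>"]) auto
    qed
    then show ?thesis using \<rho>0(1) by (intro exI[of _ "\<rho>0/2"]) auto
  qed
  have germ: "\<exists>s\<in>S'. \<exists>W. (z, z') \<in> s \<and> openin mtopology W \<and> z \<in> W \<and>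
        (\<forall>w\<in>W. \<forall>w'. (w, w') \<in> s \<longrightarrow> (w, w') \<in> g)" if g: "g \<in> H" "(z, z') \<in> g" for g z z'
  proof -
    have inv: "s\<inverse> \<in> S'" if "s \<in> S'" for s
      using that S(3) by (auto simp: S'_def)
    have id: "Id_on (topspace mtopology) \<in> S'" by (simp add: S'_def)
    show ?thesis
      by (rule generated_pseudogroup_germ[OF H S'H inv comp id gen[OF g(1)] g(2)])
  qed
  show ?thesis
  proof (rule that[of S'])
    show "Id_on M \<in> S'" by (simp add: S'_def)
  qed (intro ballI allI impI S'H comp germ equi; assumption)+
qed

text \<open>The neighbourhoods on which \<open>h\<close> is represented by elements of
  \<open>S\<close> vary with the point; a Lebesgue number over \<open>K\<close> makes their size
  uniform. Both memberships of \<open>(w, w')\<close> matter: \<open>s\<close> can be composed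
  inside \<open>S\<close>, while \<open>h\<close> is the concrete map.\<close>

lemma (in Metric_space) uniform_germs:
  assumes lt: "\<And>s. s \<in> S \<Longrightarrow> local_transformation mtopology s"
    and h: "local_transformation mtopology h"
    and germ: "\<And>z z'. (z, z') \<in> h \<Longrightarrow> \<exists>s\<in>S. \<exists>W. (z, z') \<in> s \<and> openin mtopology W \<and> z \<in> W \<and>
        (\<forall>w\<in>W. \<forall>w'. (w, w') \<in> s \<longrightarrow> (w, w') \<in> h)"
    and K: "compactin mtopology K" "K \<subseteq> Domain h" and "\<rho> > 0"
  obtains \<eta> where "\<eta> > 0" "\<forall>z\<in>K. \<forall>z'. (z, z') \<in> h \<longrightarrow> (\<exists>s\<in>S. (z, z') \<in> s \<and>
      (\<forall>w\<in>M. d z w < \<eta> \<longrightarrow> (\<exists>w'. (w, w') \<in> s \<and> (w, w') \<in> h \<and> d z' w' < \<rho>)))"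
proof -
  \<comment> \<open>Values lie near a fixed \<open>t\<close>, not near the image of a chosen point,
    so that any two points of \<open>W\<close> have images less than \<rho> apart.\<close>
  define good where "good = (\<lambda>W s t. \<forall>w\<in>W. \<exists>w'\<in>mball t (\<rho>/2). (w, w') \<in> s \<and> (w, w') \<in> h)"
  define \<U> where "\<U> = {W. openin mtopology W \<and> (\<exists>s\<in>S. \<exists>t\<in>M. good W s t)}"
  have "K \<subseteq> \<Union>\<U>"
  proof
    fix z assume "z \<in> K"
    then obtain z' where z': "(z, z') \<in> h" using K(2) by blast
    then have M: "z \<in> M" "z' \<in> M" using local_transformation_subset_topspace[OF h] by auto
    obtain s W where s: "s \<in> S" "(z, z') \<in> s" "openin mtopology W" "z \<in> W"
        "\<forall>w\<in>W. \<forall>w'. (w, w') \<in> s \<longrightarrow> (w, w') \<in> h" using germ[OF z'] by blast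
    have "z' \<in> mball z' (\<rho>/2)" using M \<open>\<rho> > 0\<close> by auto
    then obtain W' where W': "openin mtopology W'" "z \<in> W'"
        "\<And>w. w \<in> W' \<Longrightarrow> \<exists>w'\<in>mball z' (\<rho>/2). (w, w') \<in> s"
      using local_transformation_continuous[OF lt[OF s(1)] s(2) openin_mball] by blast
    have "good (W \<inter> W') s z'"
      unfolding good_def
    proof
      fix w assume "w \<in> W \<inter> W'"
      then show "\<exists>w'\<in>mball z' (\<rho>/2). (w, w') \<in> s \<and> (w, w') \<in> h"
        using W'(3)[of w] s(5) by (metis IntE)
    qed
    then have "W \<inter> W' \<in> \<U>"
      using s(1,3) W'(1) M(2) unfolding \<U>_def by blast
    then show "z \<in> \<Union>\<U>" using s(4) W'(2) by blast
  qed
  then obtain \<eta> where \<eta>: "\<eta> > 0" "\<forall>z\<in>K. \<exists>U\<in>\<U>. mball z \<eta> \<subseteq> U"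
    using lebesgue_number[OF K(1), of \<U>] unfolding \<U>_def by blast
  show ?thesis
  proof (rule that[OF \<eta>(1)], intro ballI allI impI)
    fix z z' assume z: "z \<in> K" "(z, z') \<in> h"
    then have M: "z \<in> M" "z' \<in> M" using local_transformation_subset_topspace[OF h] by auto
    obtain W s t where W: "mball z \<eta> \<subseteq> W" "s \<in> S" "t \<in> M" "good W s t"
      using \<eta>(2) z(1) unfolding \<U>_def by blast
    have "z \<in> W" using W(1) M \<eta>(1) by auto
    then obtain z1 where "z1 \<in> mball t (\<rho>/2)" "(z, z1) \<in> s" "(z, z1) \<in> h" using W(4) unfolding good_def by meson
    moreover from this have "z1 = z'" using local_transformation_unique[OF h z(2)] by blast
    ultimately have z1: "z' \<in> mball t (\<rho>/2)" "(z, z') \<in> s" by auto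
    have "\<exists>w'. (w, w') \<in> s \<and> (w, w') \<in> h \<and> d z' w' < \<rho>" if w: "w \<in> M" "d z w < \<eta>" for w
    proof -
      have "w \<in> W" using W(1) M w by auto
      then obtain w' where w': "w' \<in> mball t (\<rho>/2)" "(w, w') \<in> s" "(w, w') \<in> h" using W(4) unfolding good_def by meson
      then have "d z' w' < \<rho>"
        using z1(1) triangle[of z' t w'] commute[of z' t] by auto
      then show ?thesis using w' by blast
    qed
    then show "\<exists>s\<in>S. (z, z') \<in> s \<and>
      (\<forall>w\<in>M. d z w < \<eta> \<longrightarrow> (\<exists>w'. (w, w') \<in> s \<and> (w, w') \<in> h \<and> d z' w' < \<rho>))"
      using W(2) z1(2) by blast
  qed
qed

section \<open>Plaques and leaves\<close>

text \<open>The ball is a union of segments \<open>\<gamma> x\<close> through \<open>a\<close>.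
  Coordinates from \<open>n\<close> on vanish at both ends, so these segments stay in
  \<open>Euclidean_space n\<close>.\<close>

lemma connectedin_Euclidean_ball:
  assumes a: "a \<in> topspace (Euclidean_space n)" and "r > 0"
  shows "connectedin (Euclidean_space n) (Euclidean_ball n a r)"
proof -
  define \<gamma> where "\<gamma> = (\<lambda>x t i. a i + t * (x i - a i) :: real)"
  have a0: "a i = 0" if "i \<ge> n" for i using a that by (simp add: topspace_Euclidean_space)
  have conn: "connectedin (Euclidean_space n) (\<gamma> x ` {0..1})" if x: "x \<in> Euclidean_ball n a r" for x
  proof (rule connectedin_continuous_map_image)
    show "continuous_map euclideanreal (Euclidean_space n) (\<gamma> x)"
      using x a0 unfolding Euclidean_space_def continuous_map_in_subtopology continuous_map_componentwise_UNIV
      by (auto simp: \<gamma>_def Euclidean_ball_def topspace_Euclidean_space intro!: continuous_intros)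
  qed simp
  have sub: "\<gamma> x t \<in> Euclidean_ball n a r" if x: "x \<in> Euclidean_ball n a r" and t: "t \<in> {0..1}" for x t
  proof -
    have "sqrt (\<Sum>i<n. (\<gamma> x t i - a i)\<^sup>2) = sqrt (t\<^sup>2 * (\<Sum>i<n. (x i - a i)\<^sup>2))"
      by (simp add: \<gamma>_def power_mult_distrib sum_distrib_left)
    also have "\<dots> = t * sqrt (\<Sum>i<n. (x i - a i)\<^sup>2)"
      using t by (simp add: real_sqrt_mult)
    also have "\<dots> \<le> sqrt (\<Sum>i<n. (x i - a i)\<^sup>2)"
      using t by (intro mult_left_le_one_le) (auto intro: sum_nonneg)
    also have "\<dots> < r" using x by (simp add: Euclidean_ball_def)
    finally show ?thesis
      using x a0 by (simp add: Euclidean_ball_def topspace_Euclidean_space \<gamma>_def)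
  qed
  have "x \<in> \<gamma> x ` {0..1}" for x
    by (rule image_eqI[of _ _ 1]) (auto simp: \<gamma>_def)
  then have eq: "Euclidean_ball n a r = (\<Union>x\<in>Euclidean_ball n a r. \<gamma> x ` {0..1})"
    using sub by auto
  have "a \<in> \<gamma> x ` {0..1}" for x
    by (rule image_eqI[of _ _ 0]) (auto simp: \<gamma>_def)
  then have "a \<in> \<Inter>((\<lambda>x. \<gamma> x ` {0..1}) ` Euclidean_ball n a r)" by auto
  then have "\<Inter>((\<lambda>x. \<gamma> x ` {0..1}) ` Euclidean_ball n a r) \<noteq> {}" by blast
  then show ?thesis
    by (subst eq, intro connectedin_Union) (use conn in blast)+
qed

section \<open>Flow boxes, projections and plaques\<close>

lemma closure_of_meets_open:
  assumes "u \<in> X closure_of S" "openin X W" "u \<in> W"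
  obtains l where "l \<in> S" "l \<in> W"
  using assms by (auto simp: in_closure_of)

lemma flow_box_on_open_dom: "flow_box_on n X c \<Longrightarrow> openin X (fb_dom c)"
  by (simp add: flow_box_on_def)

lemma flow_box_on_dom_subset: "flow_box_on n X c \<Longrightarrow> fb_dom c \<subseteq> topspace X"
  using flow_box_on_open_dom openin_subset by blast

lemma continuous_map_fb_proj:
  assumes "flow_box_on n X c"
  shows "continuous_map (subtopology X (fb_dom c)) (fb_trans c) (fb_proj c)"
proof -
  have "fb_proj c = snd \<circ> fb_map c" by (auto simp: fb_proj_def)
  then show ?thesis
    using assms continuous_map_compose[OF homeomorphic_imp_continuous_map continuous_map_snd]
    unfolding flow_box_on_def by metis
qed

lemma openin_fb_proj_image:
  assumes c: "flow_box_on n X c" and W: "openin X W" "W \<subseteq> fb_dom c"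
  shows "openin (fb_trans c) (fb_proj c ` W)"
proof -
  have "openin (subtopology X (fb_dom c)) W"
    using W by (metis inf.absorb1 openin_subtopology)
  moreover have "open_map (subtopology X (fb_dom c))
      (prod_topology (subtopology (Euclidean_space n) (fb_ball c)) (fb_trans c)) (fb_map c)"
    using c homeomorphic_imp_open_map unfolding flow_box_on_def by blast
  ultimately have "openin (fb_trans c) (snd ` fb_map c ` W)"
    using open_map_snd unfolding open_map_def by blast
  then show ?thesis by (simp add: fb_proj_def image_image)
qed

lemma fb_proj_in_topspace:
  assumes "flow_box_on n X c" "x \<in> fb_dom c"
  shows "fb_proj c x \<in> topspace (fb_trans c)"
  using openin_subset[OF openin_fb_proj_image[OF assms(1) flow_box_on_open_dom[OF assms(1)]]] assms(2)
  by auto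

lemma connectedin_plaque:
  assumes c: "flow_box_on n X c" and z: "z \<in> topspace (fb_trans c)"
  shows "connectedin X (plaque c z)"
proof -
  obtain a r where ball: "a \<in> topspace (Euclidean_space n)" "r > 0" "fb_ball c = Euclidean_ball n a r"
    and hom: "homeomorphic_map (subtopology X (fb_dom c))
       (prod_topology (subtopology (Euclidean_space n) (fb_ball c)) (fb_trans c)) (fb_map c)"
    using c unfolding flow_box_on_def by blast
  let ?P = "prod_topology (subtopology (Euclidean_space n) (fb_ball c)) (fb_trans c)"
  have top: "topspace (subtopology X (fb_dom c)) = fb_dom c"
    using flow_box_on_dom_subset[OF c] by auto
  have sub: "fb_ball c \<subseteq> topspace (Euclidean_space n)"
    unfolding ball by (auto simp: Euclidean_ball_def)
  obtain g where g: "homeomorphic_maps (subtopology X (fb_dom c)) ?P (fb_map c) g"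
    using hom homeomorphic_map_maps by blast
  have "connectedin ?P (fb_ball c \<times> {z})"
    unfolding connectedin_Times
    using connectedin_Euclidean_ball[OF ball(1,2)] z by (auto simp: ball(3) connectedin_subtopology)
  then have "connectedin (subtopology X (fb_dom c)) (g ` (fb_ball c \<times> {z}))"
    using g connectedin_continuous_map_image unfolding homeomorphic_maps_def by blast
  moreover have "g ` (fb_ball c \<times> {z}) = plaque c z"
  proof -
    have 1: "g (fb_map c x) = x" "fst (fb_map c x) \<in> fb_ball c" if "x \<in> fb_dom c" for x
    proof -
      show "g (fb_map c x) = x" using g that top unfolding homeomorphic_maps_def by auto
      have "fb_map c x \<in> topspace ?P"
        using homeomorphic_imp_surjective_map[OF hom] that top by blast
      then show "fst (fb_map c x) \<in> fb_ball c" by auto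
    qed
    have 2: "fb_map c (g q) = q" "g q \<in> fb_dom c" if "q \<in> fb_ball c \<times> {z}" for q
    proof -
      have q: "q \<in> topspace ?P" using that z sub by auto
      then show "fb_map c (g q) = q" using g unfolding homeomorphic_maps_def by auto
      have "g ` topspace ?P \<subseteq> topspace (subtopology X (fb_dom c))"
        using g continuous_map_image_subset_topspace unfolding homeomorphic_maps_def by blast
      then show "g q \<in> fb_dom c" using q top by blast
    qed
    show ?thesis
    proof (intro subset_antisym subsetI)
      fix x assume "x \<in> g ` (fb_ball c \<times> {z})"
      then obtain q where "q \<in> fb_ball c \<times> {z}" "x = g q" by blast
      then show "x \<in> plaque c z" using 2[of q] by (auto simp: plaque_def fb_proj_def)
    next
      fix x assume "x \<in> plaque c z"
      then have x: "x \<in> fb_dom c" "snd (fb_map c x) = z" by (auto simp: plaque_def fb_proj_def)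
      then have "fb_map c x \<in> fb_ball c \<times> {z}" using 1(2) by (simp add: mem_Times_iff)
      then show "x \<in> g ` (fb_ball c \<times> {z})" using 1(1)[OF x(1)] by force
    qed
  qed
  ultimately show ?thesis by (simp add: connectedin_subtopology)
qed

section \<open>Leaves seen through two compatible atlases\<close>

lemma foliated_spaceD:
  assumes "foliated_space n k X A"
  shows "c \<in> A \<Longrightarrow> flow_box_on n X c" "\<Union> (fb_dom ` A) = topspace X"
    "c \<in> A \<Longrightarrow> d \<in> A \<Longrightarrow> foliated_change n k X c d" "polish_topology X"
  using assms unfolding foliated_space_def by simp_all

text \<open>The transverse maps of the two opposite changes give one implication each. The result is
  local because these maps are only given near each point.\<close>

lemma foliated_change_plaques_agree:
  assumes "foliated_change n k X c d" "foliated_change n k X d c" "u \<in> fb_dom c \<inter> fb_dom d"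
  obtains N where "openin X N" "u \<in> N" "N \<subseteq> fb_dom c \<inter> fb_dom d"
    "\<And>v. v \<in> N \<Longrightarrow> fb_proj c v = fb_proj c u \<longleftrightarrow> fb_proj d v = fb_proj d u"
proof -
  obtain N \<zeta> where N: "openin X N" "u \<in> N" "N \<subseteq> fb_dom c \<inter> fb_dom d"
    "\<forall>y \<in> N. fb_proj c y = \<zeta> (fb_proj d y)"
    using assms unfolding foliated_change_def by meson
  obtain N' \<zeta>' where N': "openin X N'" "u \<in> N'" "\<forall>y \<in> N'. fb_proj d y = \<zeta>' (fb_proj c y)"
    using assms(2,3) unfolding foliated_change_def by (metis Int_commute)
  show ?thesis
  proof (rule that[of "N \<inter> N'"])
    fix v assume "v \<in> N \<inter> N'"
    then show "fb_proj c v = fb_proj c u \<longleftrightarrow> fb_proj d v = fb_proj d u"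
      using N(2,4) N'(2,3) by (metis IntE)
  qed (use N N' in auto)
qed

text \<open>\<open>A\<close> is the atlas that defines the leaves, \<open>A'\<close> the one that
  carries the holonomy pseudogroup.\<close>

locale compatible_atlases =
  fixes n k and X :: "'a topology" and A A' :: "('a, 'z) flow_box set"
  assumes A: "foliated_space n k X A" and A': "foliated_space n k X A'"
    and AA': "foliated_space n k X (A \<union> A')"
begin

lemma flow_box: "c \<in> A \<union> A' \<Longrightarrow> flow_box_on n X c"
  using foliated_spaceD(1)[OF AA'] .

lemma flow_box_covering: "u \<in> topspace X \<Longrightarrow> \<exists>c\<in>A. u \<in> fb_dom c" "u \<in> topspace X \<Longrightarrow> \<exists>c\<in>A'. u \<in> fb_dom c"
  using foliated_spaceD(2)[OF A] foliated_spaceD(2)[OF A'] by blast+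

lemma plaques_agree:
  assumes "c \<in> A \<union> A'" "d \<in> A \<union> A'" "u \<in> fb_dom c" "u \<in> fb_dom d"
  obtains N where "openin X N" "u \<in> N" "N \<subseteq> fb_dom c \<inter> fb_dom d"
    "\<And>v. v \<in> N \<Longrightarrow> fb_proj c v = fb_proj c u \<longleftrightarrow> fb_proj d v = fb_proj d u"
proof -
  have "foliated_change n k X c d" "foliated_change n k X d c"
    using foliated_spaceD(3)[OF AA'] assms(1,2) by simp_all
  then show ?thesis using foliated_change_plaques_agree that assms(3,4) by (metis IntI)
qed

text \<open>Near each of its points a plaque of \<open>c\<close> coincides with a plaque of some box
  of \<open>A\<close>, where small pieces are generators of the leaf topology. Boxes of
  \<open>A'\<close> can thus be used to explore leaves of \<open>A\<close>.\<close>

lemma openin_leaf_topology: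
  assumes c: "c \<in> A \<union> A'" and W: "openin X W"
  shows "openin (leaf_topology X A) (W \<inter> plaque c z)"
proof (subst openin_subopen, intro ballI)
  fix u assume "u \<in> W \<inter> plaque c z"
  then have u: "u \<in> W" "u \<in> fb_dom c" "fb_proj c u = z" by (auto simp: plaque_def)
  then have "u \<in> topspace X" using W openin_subset by blast
  then obtain d where d: "d \<in> A" "u \<in> fb_dom d" using flow_box_covering(1) by blast
  then obtain N where N: "openin X N" "u \<in> N" "N \<subseteq> fb_dom c \<inter> fb_dom d"
    "\<And>v. v \<in> N \<Longrightarrow> fb_proj c v = fb_proj c u \<longleftrightarrow> fb_proj d v = fb_proj d u"
    using plaques_agree[of c d u] c u(2) by blast
  let ?V = "(N \<inter> W) \<inter> plaque d (fb_proj d u)"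
  have "openin (subtopology X (plaque d (fb_proj d u))) ?V"
    unfolding openin_subtopology using N(1) W by blast
  moreover have "fb_proj d u \<in> topspace (fb_trans d)"
    using fb_proj_in_topspace[OF flow_box d(2)] d(1) by simp
  ultimately have "openin (leaf_topology X A) ?V"
    unfolding leaf_topology_def using d by (intro topology_generated_by_Basis) blast
  moreover have "?V \<subseteq> W \<inter> plaque c z"
    using N(3,4) u(3) by (auto simp: plaque_def)
  moreover have "u \<in> ?V" using N u d by (auto simp: plaque_def)
  ultimately show "\<exists>T. openin (leaf_topology X A) T \<and> u \<in> T \<and> T \<subseteq> W \<inter> plaque c z" by blast
qed

lemma topspace_leaf_topology: "topspace (leaf_topology X A) = topspace X"
proof
  have "V \<subseteq> topspace X" if "openin (subtopology X (plaque c z)) V" for V and c :: "('a, 'z) flow_box" and z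
    using openin_subset[OF that] by auto
  then show "topspace (leaf_topology X A) \<subseteq> topspace X"
    unfolding leaf_topology_def topology_generated_by_topspace by blast
  show "topspace X \<subseteq> topspace (leaf_topology X A)"
  proof
    fix u assume u: "u \<in> topspace X"
    then obtain c where c: "c \<in> A" "u \<in> fb_dom c" using flow_box_covering(1) by blast
    then have "u \<in> topspace X \<inter> plaque c (fb_proj c u)" using u by (auto simp: plaque_def)
    then show "u \<in> topspace (leaf_topology X A)"
      using openin_subset[OF openin_leaf_topology[of c "topspace X" "fb_proj c u"]] c by blast
  qed
qed

abbreviation same_leaf :: "'a \<Rightarrow> 'a \<Rightarrow> bool" where
  "same_leaf \<equiv> connected_component_of (leaf_topology X A)"

text \<open>A plaque is connected in \<open>X\<close>, but the leaf topology is finer, so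
  connectedness does not pass over by itself. It does because the identity, from the plaque as a
  subspace of \<open>X\<close> to the leaf topology, is continuous: plaques of different boxes agree
  locally.\<close>

lemma same_plaque_imp_same_leaf:
  assumes c: "c \<in> A \<union> A'" and u: "u \<in> fb_dom c" "v \<in> fb_dom c" "fb_proj c u = fb_proj c v"
  shows "same_leaf u v"
proof -
  let ?P = "plaque c (fb_proj c u)"
  have P: "?P \<subseteq> topspace X" using flow_box_on_dom_subset[OF flow_box[OF c]] by (auto simp: plaque_def)
  have conn: "connectedin X ?P"
    by (rule connectedin_plaque[OF flow_box[OF c] fb_proj_in_topspace[OF flow_box[OF c] u(1)]])
  have "continuous_map (subtopology X ?P) (leaf_topology X A) id"
    unfolding leaf_topology_def continuous_on_generated_topo_iff
  proof (intro conjI allI impI)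
    have "?P \<subseteq> topspace (leaf_topology X A)" using P topspace_leaf_topology by simp
    then show "id ` topspace (subtopology X ?P)
        \<subseteq> \<Union>{V. \<exists>c\<in>A. \<exists>z\<in>topspace (fb_trans c). openin (subtopology X (plaque c z)) V}"
      unfolding leaf_topology_def by auto
    fix V assume "V \<in> {V. \<exists>c\<in>A. \<exists>z\<in>topspace (fb_trans c). openin (subtopology X (plaque c z)) V}"
    then obtain d z W where d: "d \<in> A" "openin X W" "V = W \<inter> plaque d z"
      unfolding openin_subtopology by blast
    have "openin (subtopology X ?P) (V \<inter> ?P)"
    proof (subst openin_subopen, intro ballI)
      fix y assume "y \<in> V \<inter> ?P"
      then have y: "y \<in> W" "y \<in> fb_dom d" "fb_proj d y = z" "y \<in> fb_dom c" "fb_proj c y = fb_proj c u"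
        by (auto simp: d plaque_def)
      then obtain N where N: "openin X N" "y \<in> N" "N \<subseteq> fb_dom c \<inter> fb_dom d"
        "\<And>v. v \<in> N \<Longrightarrow> fb_proj c v = fb_proj c y \<longleftrightarrow> fb_proj d v = fb_proj d y"
        using plaques_agree[of c d y] c d by blast
      have "openin (subtopology X ?P) ((N \<inter> W) \<inter> ?P)"
        unfolding openin_subtopology using N(1) d(2) by blast
      moreover have "(N \<inter> W) \<inter> ?P \<subseteq> V \<inter> ?P"
        using N(3,4) y by (auto simp: plaque_def d)
      moreover have "y \<in> (N \<inter> W) \<inter> ?P" using N y by (auto simp: plaque_def)
      ultimately show "\<exists>T. openin (subtopology X ?P) T \<and> y \<in> T \<and> T \<subseteq> V \<inter> ?P" by blast
    qed
    moreover have "id -` V \<inter> topspace (subtopology X ?P) = V \<inter> ?P" using P by auto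
    ultimately show "openin (subtopology X ?P) (id -` V \<inter> topspace (subtopology X ?P))" by simp
  qed
  moreover have "connectedin (subtopology X ?P) ?P"
    using conn by (simp add: connectedin_subtopology)
  ultimately have "connectedin (leaf_topology X A) (id ` ?P)"
    by (rule connectedin_continuous_map_image)
  moreover have "u \<in> ?P" "v \<in> ?P" using u by (auto simp: plaque_def)
  ultimately show ?thesis unfolding connected_component_of_def by auto
qed

text \<open>The hypothesis makes \<open>D\<close> and its complement open in the leaf topology, and
  a connected set cannot meet both. This propagates local statements about plaques along whole
  leaves.\<close>

lemma same_leaf_invariant:
  assumes D: "\<And>u. u \<in> topspace X \<Longrightarrow> \<exists>c\<in>A'. \<exists>W. openin X W \<and> u \<in> W \<and> W \<subseteq> fb_dom c \<and>
      (\<forall>v\<in>W. fb_proj c v = fb_proj c u \<longrightarrow> (v \<in> D \<longleftrightarrow> u \<in> D))"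
    and uv: "same_leaf u v" "u \<in> D"
  shows "v \<in> D"
proof -
  \<comment> \<open>Stated for \<open>E\<close> so as to cover both \<open>D\<close> and
    \<open>- D\<close>.\<close>
  have op: "openin (leaf_topology X A) (topspace X \<inter> E)"
    if E: "\<And>u v. u \<in> E \<Longrightarrow> (v \<in> D \<longleftrightarrow> u \<in> D) \<Longrightarrow> v \<in> E" for E
  proof (subst openin_subopen, intro ballI)
    fix u assume u: "u \<in> topspace X \<inter> E"
    then obtain c W where W: "c \<in> A'" "openin X W" "u \<in> W" "W \<subseteq> fb_dom c"
      "\<forall>v\<in>W. fb_proj c v = fb_proj c u \<longrightarrow> (v \<in> D \<longleftrightarrow> u \<in> D)"
      using D[of u] by blast
    have "openin (leaf_topology X A) (W \<inter> plaque c (fb_proj c u))"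
      using openin_leaf_topology W by blast
    moreover have "u \<in> W \<inter> plaque c (fb_proj c u)" using W by (auto simp: plaque_def)
    moreover have "W \<inter> plaque c (fb_proj c u) \<subseteq> topspace X \<inter> E"
    proof
      fix v assume "v \<in> W \<inter> plaque c (fb_proj c u)"
      then have v: "v \<in> W" "fb_proj c v = fb_proj c u" by (auto simp: plaque_def)
      then have "v \<in> E" using E[of u v] u W(5) by blast
      then show "v \<in> topspace X \<inter> E" using v(1) W(2) openin_subset by blast
    qed
    ultimately show "\<exists>T. openin (leaf_topology X A) T \<and> u \<in> T \<and> T \<subseteq> topspace X \<inter> E" by blast
  qed
  obtain C where C: "connectedin (leaf_topology X A) C" "u \<in> C" "v \<in> C"
    using uv(1) unfolding connected_component_of_def by blast
  have "C \<subseteq> topspace X" using C(1) connectedin_subset_topspace topspace_leaf_topology by blast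
  show ?thesis
  proof (rule ccontr)
    let ?E1 = "topspace X \<inter> D" and ?E2 = "topspace X \<inter> - D"
    assume "v \<notin> D"
    then have "openin (leaf_topology X A) ?E1 \<and> openin (leaf_topology X A) ?E2 \<and> C \<subseteq> ?E1 \<union> ?E2 \<and>
        ?E1 \<inter> ?E2 \<inter> C = {} \<and> ?E1 \<inter> C \<noteq> {} \<and> ?E2 \<inter> C \<noteq> {}"
      using C(2,3) \<open>C \<subseteq> topspace X\<close> uv(2) op[of D] op[of "- D"] by auto
    then show False using C(1) unfolding connectedin by metis
  qed
qed

text \<open>Inside a flow box, the plaques that meet an open set have open union. If
  \<open>u\<close> and \<open>v\<close> share a plaque, a leaf point close enough to
  \<open>u\<close> can therefore be moved along its own plaque to a point close to \<open>v\<close>.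
  Local constancy along plaques then extends to the leaf.\<close>

lemma same_leaf_closure:
  assumes y: "y \<in> X closure_of {v. same_leaf x v}" and R: "same_leaf y y'"
  shows "y' \<in> X closure_of {v. same_leaf x v}"
proof -
  have step: "v \<in> X closure_of {v. same_leaf x v}"
    if c: "c \<in> A'" "u \<in> fb_dom c" "v \<in> fb_dom c" "fb_proj c v = fb_proj c u"
      and u: "u \<in> X closure_of {v. same_leaf x v}" for c u v
    unfolding in_closure_of
  proof (intro conjI allI impI)
    have fc: "flow_box_on n X c" using flow_box[of c] c(1) by simp
    show "v \<in> topspace X" using flow_box_on_dom_subset[OF fc] c by blast
    fix W assume W: "v \<in> W \<and> openin X W"
    have "openin (fb_trans c) (fb_proj c ` (W \<inter> fb_dom c))"
      using W flow_box_on_open_dom[OF fc] by (intro openin_fb_proj_image[OF fc]) auto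
    then have "openin (subtopology X (fb_dom c))
        {p \<in> topspace (subtopology X (fb_dom c)). fb_proj c p \<in> fb_proj c ` (W \<inter> fb_dom c)}" (is "openin _ ?E")
      by (rule openin_continuous_map_preimage[OF continuous_map_fb_proj[OF fc]])
    then have "openin X ?E" using flow_box_on_open_dom[OF fc] openin_trans_full by blast
    moreover have "u \<in> ?E" using c W flow_box_on_dom_subset[OF fc] by (auto intro!: image_eqI[of _ _ v])
    ultimately obtain l where l: "same_leaf x l" "l \<in> ?E"
      using closure_of_meets_open[OF u, of ?E] by (metis mem_Collect_eq)
    then obtain l' where l': "l' \<in> W" "l' \<in> fb_dom c" "fb_proj c l = fb_proj c l'" "l \<in> fb_dom c" by auto
    then have "same_leaf l l'" using same_plaque_imp_same_leaf[of c l l'] c(1) by simp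
    then have "same_leaf x l'" using l(1) connected_component_of_trans by metis
    then show "\<exists>y. y \<in> {v. same_leaf x v} \<and> y \<in> W" using l'(1) by blast
  qed
  show ?thesis
  proof (rule same_leaf_invariant[OF _ R y])
    fix u assume "u \<in> topspace X"
    then obtain c where c: "c \<in> A'" "u \<in> fb_dom c" using flow_box_covering(2) by blast
    have "openin X (fb_dom c)" using flow_box_on_open_dom[OF flow_box[of c]] c(1) by simp
    moreover have "v \<in> X closure_of {v. same_leaf x v} \<longleftrightarrow> u \<in> X closure_of {v. same_leaf x v}"
      if "v \<in> fb_dom c" "fb_proj c v = fb_proj c u" for v
      using step[OF c(1) c(2) that] step[OF c(1) that(1) c(2) that(2)[symmetric]] by blast
    ultimately show "\<exists>c\<in>A'. \<exists>W. openin X W \<and> u \<in> W \<and> W \<subseteq> fb_dom c \<and>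
      (\<forall>v\<in>W. fb_proj c v = fb_proj c u \<longrightarrow>
        (v \<in> X closure_of {v. same_leaf x v} \<longleftrightarrow> u \<in> X closure_of {v. same_leaf x v}))"
      by (intro bexI[OF _ c(1)] exI[of _ "fb_dom c"] conjI ballI impI c(2) order_refl)
  qed
qed

end

section \<open>Leaf closures\<close>

lemma finite_uniform_radius:
  fixes P :: "'b \<Rightarrow> real \<Rightarrow> bool"
  assumes "finite I" and ex: "\<And>i. i \<in> I \<Longrightarrow> \<exists>\<eta>>0. P i \<eta>"
    and mono: "\<And>i \<eta> \<eta>'. P i \<eta> \<Longrightarrow> 0 < \<eta>' \<Longrightarrow> \<eta>' \<le> \<eta> \<Longrightarrow> P i \<eta>'"
  obtains \<eta> where "\<eta> > 0" "\<And>i. i \<in> I \<Longrightarrow> P i \<eta>"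
proof -
  obtain e where e: "\<And>i. i \<in> I \<Longrightarrow> e i > 0" "\<And>i. i \<in> I \<Longrightarrow> P i (e i)"
    using ex by metis
  define \<eta> where "\<eta> = Min (insert 1 (e ` I))"
  have pos: "\<eta> > 0" unfolding \<eta>_def using \<open>finite I\<close> e(1) by auto
  have "P i \<eta>" if "i \<in> I" for i
  proof (rule mono[OF e(2)[OF that] pos])
    show "\<eta> \<le> e i" unfolding \<eta>_def using \<open>finite I\<close> that by (intro Min_le) auto
  qed
  then show ?thesis using that pos by blast
qed

section \<open>The holonomy space and finite covers\<close>

lemma openin_holonomy_space_image:
  assumes c: "c \<in> A" "flow_box_on n X c" and W: "openin X W" "W \<subseteq> fb_dom c"
  shows "openin (holonomy_space A) ((\<lambda>x. (c, fb_proj c x)) ` W)"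
proof -
  have "openin (holonomy_space A) (Pair c ` fb_proj c ` W)"
    using open_map_component_injection[OF c(1), of fb_trans] openin_fb_proj_image[OF c(2) W]
    unfolding open_map_def holonomy_space_def by blast
  then show ?thesis by (simp add: image_image)
qed

lemma continuous_map_holonomy_space:
  assumes c: "c \<in> A" "flow_box_on n X c"
  shows "continuous_map (subtopology X (fb_dom c)) (holonomy_space A) (\<lambda>x. (c, fb_proj c x))"
  using continuous_map_compose[OF continuous_map_fb_proj[OF c(2)]
      continuous_map_component_injection[OF c(1), of fb_trans]]
  by (simp add: holonomy_space_def comp_def)

lemma metrizable_holonomy_space:
  assumes "foliated_space n k X A"
  shows "metrizable_space (holonomy_space A)"
proof -
  have "polish_topology (fb_trans c)" if "c \<in> A" for c
    using foliated_spaceD(1)[OF assms that] unfolding flow_box_on_def by blast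
  then show ?thesis
    unfolding holonomy_space_def
    by (intro metrizable_space_sum_topology)
      (simp add: polish_topology_def completely_metrizable_imp_metrizable_space)
qed

text \<open>The closures are compact inside the boxes, so their projections are the compact sets of
  transverse points over which radii can be made uniform. Points of \<open>X\<close> serve as labels
  of the pieces; several pieces may share a box.\<close>

lemma compact_foliated_space_finite_cover:
  assumes fol: "foliated_space n k X A" and X: "compact_space X"
  obtains F :: "'a set" and cc :: "'a \<Rightarrow> ('a, 'z) flow_box" and W :: "'a \<Rightarrow> 'a set"
  where "finite F" "topspace X = \<Union>(W ` F)"
    "\<forall>a\<in>F. cc a \<in> A \<and> openin X (W a) \<and> X closure_of W a \<subseteq> fb_dom (cc a)"
proof -
  have "regular_space X"
    using foliated_spaceD(4)[OF fol] unfolding polish_topology_def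
    by (simp add: completely_metrizable_imp_metrizable_space metrizable_imp_regular_space)
  then have nb: "neighbourhood_base_of (closedin X) X"
    by (simp add: neighbourhood_base_of_closedin)
  have "\<exists>c W. c \<in> A \<and> openin X W \<and> x \<in> W \<and> X closure_of W \<subseteq> fb_dom c" if x: "x \<in> topspace X" for x
  proof -
    obtain c where c: "c \<in> A" "x \<in> fb_dom c" using foliated_spaceD(2)[OF fol] x by blast
    then have "openin X (fb_dom c)" using flow_box_on_open_dom foliated_spaceD(1)[OF fol] by blast
    then obtain W V where "openin X W" "closedin X V" "x \<in> W" "W \<subseteq> V" "V \<subseteq> fb_dom c"
      using nb c(2) unfolding neighbourhood_base_of by meson
    then show ?thesis using c(1) closure_of_minimal by (meson subset_trans)
  qed
  then obtain cc W where W: "\<And>x. x \<in> topspace X \<Longrightarrow> cc x \<in> A" "\<And>x. x \<in> topspace X \<Longrightarrow> openin X (W x)"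
    "\<And>x. x \<in> topspace X \<Longrightarrow> x \<in> W x" "\<And>x. x \<in> topspace X \<Longrightarrow> X closure_of W x \<subseteq> fb_dom (cc x)"
    by metis
  have "topspace X \<subseteq> \<Union>(W ` topspace X)" using W(3) by auto
  then obtain \<F> where "finite \<F>" "\<F> \<subseteq> W ` topspace X" "topspace X \<subseteq> \<Union>\<F>"
    using X W(2) unfolding compact_space_alt by (metis (no_types, lifting) imageE)
  then obtain F where F: "finite F" "F \<subseteq> topspace X" "topspace X \<subseteq> \<Union>(W ` F)"
    using finite_subset_image[of \<F> W "topspace X"] by blast
  have sub: "W a \<subseteq> topspace X" if "a \<in> F" for a
    using W(2) F(2) that openin_subset by (meson subsetD)
  show ?thesis
  proof (rule that[OF F(1)])
    show "topspace X = \<Union>(W ` F)" using F(3) sub by blast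
    show "\<forall>a\<in>F. cc a \<in> A \<and> openin X (W a) \<and> X closure_of W a \<subseteq> fb_dom (cc a)"
      using W F(2) by (simp add: subset_iff)
  qed
qed

section \<open>Following chains of plaques\<close>

context compatible_atlases
begin

lemma leaf_closure_symmetric:
  assumes X: "compact_space X"
    and se: "strongly_equicontinuous (holonomy_space A') (holonomy_pseudogroup A')"
    and x: "x \<in> topspace X" and y: "y \<in> X closure_of {v. same_leaf x v}"
  shows "x \<in> X closure_of {v. same_leaf y v}"
proof -
  obtain M d where md: "Metric_space M d" and T: "holonomy_space A' = Metric_space.mtopology M d"
    using metrizable_holonomy_space[OF A'] unfolding metrizable_space_def by blast
  interpret Metric_space M d by (rule md)
  note se = se[unfolded T]
  have H: "pseudogroup mtopology (holonomy_pseudogroup A')"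
    using se unfolding strongly_equicontinuous_def by (rule conjunct1)
  define \<tau> where "\<tau> = (\<lambda>c u. (c, fb_proj c u) :: ('a, 'z) flow_box \<times> 'z)"
  have fb: "flow_box_on n X c" if "c \<in> A'" for c
    using flow_box[of c] that by simp
  have \<tau>_open: "openin mtopology (\<tau> c ` W)" if "c \<in> A'" "openin X W" "W \<subseteq> fb_dom c" for c W
    using openin_holonomy_space_image[OF that(1) fb[OF that(1)] that(2,3)] unfolding T \<tau>_def .
  have \<tau>_cont: "continuous_map (subtopology X (fb_dom c)) mtopology (\<tau> c)" if "c \<in> A'" for c
    using continuous_map_holonomy_space[OF that fb[OF that]] unfolding T \<tau>_def .
  have \<tau>M: "\<tau> c u \<in> M" if "c \<in> A'" "u \<in> fb_dom c" for c u
    using openin_subset[OF \<tau>_open[OF that(1) flow_box_on_open_dom[OF fb[OF that(1)]] order_refl]] that(2)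
    by auto
  have \<tau>_eq: "\<tau> c u = \<tau> c v \<longleftrightarrow> fb_proj c u = fb_proj c v" for c u v by (simp add: \<tau>_def)
  obtain F :: "'a set" and cc W where F: "finite F" "topspace X = \<Union>(W ` F)"
    and ccW: "\<forall>a\<in>F. cc a \<in> A' \<and> openin X (W a) \<and> X closure_of W a \<subseteq> fb_dom (cc a)"
    by (rule compact_foliated_space_finite_cover[OF A' X]) (rule that; assumption)
  have cc: "cc a \<in> A'" and W: "openin X (W a)" if "a \<in> F" for a
    using ccW that by simp_all
  define K where "K = (\<lambda>a. X closure_of W a)"
  have WK: "W a \<subseteq> K a" if "a \<in> F" for a
    unfolding K_def using openin_subset[OF W[OF that]] by (rule closure_of_subset)
  have KU: "K a \<subseteq> fb_dom (cc a)" if "a \<in> F" for a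
    unfolding K_def using ccW that by simp
  have WU: "u \<in> fb_dom (cc a)" if "a \<in> F" "u \<in> W a" for a u
    using WK KU that by blast
  have compact: "compactin mtopology (\<tau> (cc a) ` L)" if a: "a \<in> F" and L: "closedin X L" "L \<subseteq> K a" for a L
  proof (rule image_compactin)
    have "compactin X L" using closedin_compact_space[OF X L(1)] .
    then show "compactin (subtopology X (fb_dom (cc a))) L"
      using L(2) KU[OF a] by (simp add: compactin_subtopology)
  qed (rule \<tau>_cont[OF cc[OF a]])
  \<comment> \<open>This one compact set contains the projections of all points visited by chains,
    so \<rho> and \<delta> do not depend on the chain.\<close>
  define C where "C = (\<Union>a\<in>F. \<tau> (cc a) ` K a)"
  have C: "compactin mtopology C"
    unfolding C_def using F(1) compact by (intro compactin_Union) (auto simp: K_def)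
  have inC: "\<tau> (cc a) u \<in> C" if "a \<in> F" "u \<in> W a" for a u
    using WK that unfolding C_def by blast
  obtain S where S: "S \<subseteq> holonomy_pseudogroup A'" "Id_on M \<in> S"
    and comp: "\<forall>s\<in>S. \<forall>s'\<in>S. s O s' \<in> S"
    and germ: "\<forall>g\<in>holonomy_pseudogroup A'. \<forall>z z'. (z, z') \<in> g \<longrightarrow> (\<exists>s\<in>S. \<exists>W. (z, z') \<in> s \<and>
        openin mtopology W \<and> z \<in> W \<and> (\<forall>w\<in>W. \<forall>w'. (w, w') \<in> s \<longrightarrow> (w, w') \<in> g))"
    and equi: "\<forall>C. compactin mtopology C \<longrightarrow> (\<exists>\<rho>>0. \<forall>\<epsilon>>0. \<exists>\<delta>>0. \<forall>s\<in>S. \<forall>z\<in>C. \<forall>z'\<in>C. \<forall>w w'.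
        (z, z') \<in> s \<longrightarrow> (w, w') \<in> s \<longrightarrow> d z w < \<delta> \<longrightarrow> d z' w' < \<rho> \<longrightarrow> d z' w' < \<epsilon>)"
    by (rule strongly_equicontinuousE[OF se]) (rule that; assumption)
  have lt: "local_transformation mtopology s" if "s \<in> S" for s
    using pseudogroupD(1)[OF H] that S(1) by (meson subsetD)
  obtain \<rho> where \<rho>: "\<rho> > 0" "\<forall>\<epsilon>>0. \<exists>\<delta>>0. \<forall>s\<in>S. \<forall>z\<in>C. \<forall>z'\<in>C. \<forall>w w'.
        (z, z') \<in> s \<longrightarrow> (w, w') \<in> s \<longrightarrow> d z w < \<delta> \<longrightarrow> d z' w' < \<rho> \<longrightarrow> d z' w' < \<epsilon>"
    using equi[rule_format, OF C] by (elim exE conjE) (rule that; assumption)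
  \<comment> \<open>\<open>tracks (a, b) \<eta>\<close>: a single element of \<open>S\<close> realises the change from box \<open>a\<close> to box \<open>b\<close> on
      every \<open>\<eta>\<close>-ball around a point coming from \<open>W a \<inter> W b\<close>, with a displacement below \<open>\<rho>\<close>.\<close>
  define tracks where "tracks = (\<lambda>ab \<eta>. \<forall>u \<in> W (fst ab) \<inter> W (snd ab). \<exists>s\<in>S.
      (\<tau> (cc (fst ab)) u, \<tau> (cc (snd ab)) u) \<in> s \<and>
      (\<forall>w\<in>M. d (\<tau> (cc (fst ab)) u) w < \<eta> \<longrightarrow>
        (\<exists>w'. (w, w') \<in> s \<and> (w, w') \<in> holonomy_map (cc (fst ab)) (cc (snd ab)) \<and>
              d (\<tau> (cc (snd ab)) u) w' < \<rho>)))"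
  have "\<exists>\<eta>>0. tracks ab \<eta>" if "ab \<in> F \<times> F" for ab
  proof -
    obtain a b where ab: "ab = (a, b)" "a \<in> F" "b \<in> F" using \<open>ab \<in> F \<times> F\<close> by auto
    \<comment> \<open>\<open>K a \<inter> K b\<close> is closed, hence compact, and lies in both
      boxes, so the box change is defined on its whole projection.\<close>
    let ?h = "holonomy_map (cc a) (cc b)" and ?K = "\<tau> (cc a) ` (K a \<inter> K b)"
    have h: "?h \<in> holonomy_pseudogroup A'"
      unfolding holonomy_pseudogroup_def using cc ab(2,3) by (intro gen_base) blast
    have in_h: "(\<tau> (cc a) u, \<tau> (cc b) u) \<in> ?h" if "u \<in> K a \<inter> K b" for u
      using that KU[OF ab(2)] KU[OF ab(3)] unfolding holonomy_map_def \<tau>_def by blast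
    have K_compact: "compactin mtopology ?K"
      by (rule compact[OF ab(2)]) (auto simp: K_def)
    have K_dom: "?K \<subseteq> Domain ?h" using in_h by blast
    obtain \<eta> where \<eta>: "\<eta> > 0" "\<forall>z\<in>?K. \<forall>z'. (z, z') \<in> ?h \<longrightarrow> (\<exists>s\<in>S. (z, z') \<in> s \<and>
      (\<forall>w\<in>M. d z w < \<eta> \<longrightarrow> (\<exists>w'. (w, w') \<in> s \<and> (w, w') \<in> ?h \<and> d z' w' < \<rho>)))"
      by (rule uniform_germs[OF lt pseudogroupD(1)[OF H h] germ[rule_format, OF h] K_compact K_dom \<rho>(1)])
        (assumption | (rule that; assumption))+
    have "tracks ab \<eta>"
      unfolding tracks_def ab(1) fst_conv snd_conv
    proof
      fix u assume "u \<in> W a \<inter> W b"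
      then have "u \<in> K a \<inter> K b" using WK ab(2,3) by blast
      then show "\<exists>s\<in>S. (\<tau> (cc a) u, \<tau> (cc b) u) \<in> s \<and> (\<forall>w\<in>M. d (\<tau> (cc a) u) w < \<eta> \<longrightarrow>
          (\<exists>w'. (w, w') \<in> s \<and> (w, w') \<in> ?h \<and> d (\<tau> (cc b) u) w' < \<rho>))"
        by (intro \<eta>(2)[rule_format, OF imageI in_h])
    qed
    then show ?thesis using \<eta>(1) by blast
  qed
  moreover have "tracks ab \<eta>'" if "tracks ab \<eta>" "0 < \<eta>'" "\<eta>' \<le> \<eta>" for ab \<eta> \<eta>'
    using that unfolding tracks_def by (meson less_le_trans)
  ultimately obtain \<eta> where \<eta>: "\<eta> > 0" "\<And>ab. ab \<in> F \<times> F \<Longrightarrow> tracks ab \<eta>"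
    using finite_uniform_radius[of "F \<times> F" tracks] F(1) by (metis finite_cartesian_product)
  have transition: "\<exists>s\<in>S. (\<tau> (cc a) u, \<tau> (cc b) u) \<in> s \<and>
      (\<forall>w\<in>M. d (\<tau> (cc a) u) w < \<eta> \<longrightarrow>
        (\<exists>w'. (w, w') \<in> s \<and> (w, w') \<in> holonomy_map (cc a) (cc b) \<and> d (\<tau> (cc b) u) w' < \<rho>))"
    if "a \<in> F" "b \<in> F" "u \<in> W a" "u \<in> W b" for a b u
    using \<eta>(2)[of "(a, b)"] that unfolding tracks_def by simp
  have yX: "y \<in> topspace X" using y by (simp add: in_closure_of)
  obtain j where j: "j \<in> F" "y \<in> W j" using yX F(2) by blast
  obtain i where i: "i \<in> F" "x \<in> W i" using x F(2) by blast
  show ?thesis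
    unfolding in_closure_of
  proof (intro conjI x allI impI)
    fix V assume V: "x \<in> V \<and> openin X V"
    have "openin mtopology (\<tau> (cc i) ` (V \<inter> fb_dom (cc i)))"
      using V flow_box_on_open_dom[OF fb[OF cc[OF i(1)]]] cc[OF i(1)] by (intro \<tau>_open) auto
    moreover have "\<tau> (cc i) x \<in> \<tau> (cc i) ` (V \<inter> fb_dom (cc i))" using V WU[OF i] by blast
    ultimately obtain \<epsilon> where \<epsilon>: "\<epsilon> > 0" "mball (\<tau> (cc i) x) \<epsilon> \<subseteq> \<tau> (cc i) ` (V \<inter> fb_dom (cc i))"
      unfolding openin_mtopology by blast
    \<comment> \<open>\<epsilon> is the accuracy wanted at \<open>x\<close>, \<eta> the room needed
      for the next box change.\<close>
    define \<theta> where "\<theta> = min \<epsilon> \<eta>"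
    have "\<theta> > 0" using \<epsilon> \<eta> by (simp add: \<theta>_def)
    obtain \<delta> where \<delta>: "\<delta> > 0" "\<forall>s\<in>S. \<forall>z\<in>C. \<forall>z'\<in>C. \<forall>w w'.
        (z, z') \<in> s \<longrightarrow> (w, w') \<in> s \<longrightarrow> d z w < \<delta> \<longrightarrow> d z' w' < \<rho> \<longrightarrow> d z' w' < \<theta>"
      using \<rho>(2)[rule_format, OF \<open>\<theta> > 0\<close>] by (elim exE conjE) (rule that; assumption)
    let ?w = "\<tau> (cc j) y"
    have wM: "?w \<in> M" using \<tau>M[OF cc[OF j(1)] WU[OF j]] .
    \<comment> \<open>\<delta> feeds the equicontinuity estimate; \<theta> is the invariant of the
      empty chain, which is realised by the identity.\<close>
    have "openin (subtopology X (fb_dom (cc j)))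
        {u \<in> topspace (subtopology X (fb_dom (cc j))). \<tau> (cc j) u \<in> mball ?w (min \<delta> \<theta>)}" (is "openin _ ?E")
      using \<tau>_cont[OF cc[OF j(1)]] openin_mball by (rule openin_continuous_map_preimage)
    then have E_open: "openin X (?E \<inter> W j)"
      using openin_trans_full[OF _ flow_box_on_open_dom[OF fb[OF cc[OF j(1)]]]] W[OF j(1)] by blast
    have y_E: "y \<in> ?E \<inter> W j"
      using yX WU[OF j] j(2) wM \<delta>(1) \<open>\<theta> > 0\<close> by simp
    obtain x' where x': "x' \<in> {v. same_leaf x v}" "x' \<in> ?E \<inter> W j"
      by (rule closure_of_meets_open[OF y E_open y_E]) (rule that; assumption)
    then have x'_leaf: "same_leaf x' x" by (simp add: connected_component_of_sym)
    let ?z = "\<tau> (cc j) x'"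
    have xj: "x' \<in> W j" and zw: "d ?z ?w < \<delta>" "d ?z ?w < \<theta>"
      using x'(2) commute[of ?z ?w] by auto
    have zC: "?z \<in> C" using inC[OF j(1) xj] .
    have zM: "?z \<in> M" using \<tau>M[OF cc[OF j(1)] WU[OF j(1) xj]] .
    \<comment> \<open>A step moves along a plaque within one piece, leaving the transverse point
      unchanged, or changes the label at a fixed point, which calls for an element of
      \<open>S\<close>.\<close>
    define E where "E = {((u, a), (v, b)). a \<in> F \<and> b \<in> F \<and>
        (a = b \<and> u \<in> W a \<and> v \<in> W a \<and> fb_proj (cc a) u = fb_proj (cc a) v \<or>
         u = v \<and> u \<in> W a \<and> u \<in> W b)}"
    \<comment> \<open>\<open>s\<close> plays the composite so far: it carries both starting points
      to the present ones, so start and end are compared directly. The follower \<open>y'\<close>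
      stays in the leaf of \<open>y\<close> but need not lie in \<open>W a\<close>.\<close>
    define followed where "followed = (\<lambda>(u, a). a \<in> F \<and> u \<in> W a \<and>
        (\<exists>s\<in>S. (?z, \<tau> (cc a) u) \<in> s \<and>
          (\<exists>y'\<in>fb_dom (cc a). (?w, \<tau> (cc a) y') \<in> s \<and> d (\<tau> (cc a) u) (\<tau> (cc a) y') < \<theta> \<and> same_leaf y y')))"
    have followedI: "followed (u, a)"
      if "a \<in> F" "u \<in> W a" "s \<in> S" "(?z, \<tau> (cc a) u) \<in> s" "y' \<in> fb_dom (cc a)"
        "(?w, \<tau> (cc a) y') \<in> s" "d (\<tau> (cc a) u) (\<tau> (cc a) y') < \<theta>" "same_leaf y y'" for u a s y'
      unfolding followed_def prod.case using that by (intro conjI bexI[of _ s] bexI[of _ y'])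
    have follow: "followed p" if "((x', j), p) \<in> E\<^sup>*" for p
      using that
    proof induction
      case base
      have "same_leaf y y" using yX by (simp add: connected_component_of_refl topspace_leaf_topology)
      then show ?case
        using zM wM by (intro followedI[OF j(1) xj S(2) _ WU[OF j] _ zw(2)]) (simp_all add: Id_on_iff)
    next
      case (step p q)
      obtain u a v b where pq: "p = (u, a)" "q = (v, b)" by (metis prod.collapse)
      obtain s y' where s: "a \<in> F" "u \<in> W a" "s \<in> S" "(?z, \<tau> (cc a) u) \<in> s" "y' \<in> fb_dom (cc a)"
        "(?w, \<tau> (cc a) y') \<in> s" "d (\<tau> (cc a) u) (\<tau> (cc a) y') < \<theta>" "same_leaf y y'"
        using step.IH unfolding followed_def pq prod.case
        by (elim bexE conjE) (rule that; assumption)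
      have E: "a \<in> F" "b \<in> F" "a = b \<and> u \<in> W a \<and> v \<in> W a \<and> fb_proj (cc a) u = fb_proj (cc a) v \<or>
         u = v \<and> u \<in> W a \<and> u \<in> W b"
        using step.hyps(2) unfolding E_def pq by auto
      from E(3) show ?case
      proof (elim disjE conjE)
        assume uv: "a = b" "v \<in> W a" "fb_proj (cc a) u = fb_proj (cc a) v"
        then have eq: "\<tau> (cc a) v = \<tau> (cc a) u" by (simp add: \<tau>_eq)
        show ?case
          unfolding pq uv(1)[symmetric]
          by (rule followedI[OF s(1) uv(2) s(3) _ s(5,6) _ s(8)]) (simp_all only: eq s(4,7))
      next
        assume uv: "u = v" "u \<in> W a" "u \<in> W b"
        have "d (\<tau> (cc a) u) (\<tau> (cc a) y') < \<eta>" using s(7) by (simp add: \<theta>_def)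
        moreover obtain s' where s': "s' \<in> S" "(\<tau> (cc a) u, \<tau> (cc b) u) \<in> s'"
          "\<forall>w\<in>M. d (\<tau> (cc a) u) w < \<eta> \<longrightarrow>
            (\<exists>w'. (w, w') \<in> s' \<and> (w, w') \<in> holonomy_map (cc a) (cc b) \<and> d (\<tau> (cc b) u) w' < \<rho>)"
          using transition[OF E(1,2) uv(2,3)] by (elim bexE conjE) (rule that; assumption)
        ultimately obtain w' where w': "(\<tau> (cc a) y', w') \<in> s'"
          "(\<tau> (cc a) y', w') \<in> holonomy_map (cc a) (cc b)" "d (\<tau> (cc b) u) w' < \<rho>"
          using \<tau>M[OF cc[OF E(1)] s(5)] by blast
        \<comment> \<open>\<open>y'\<close> itself need not lie in the box of \<open>b\<close>;
          membership in the holonomy map supplies a point \<open>y1\<close> of its plaque that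
          does.\<close>
        obtain y1 where y1: "y1 \<in> fb_dom (cc a)" "y1 \<in> fb_dom (cc b)" "\<tau> (cc a) y' = \<tau> (cc a) y1"
          "w' = \<tau> (cc b) y1"
          using w'(2) unfolding holonomy_map_def \<tau>_def by blast
        have "same_leaf y' y1"
          using same_plaque_imp_same_leaf[of "cc a" y' y1] cc[OF E(1)] s(5) y1(1,3) by (simp add: \<tau>_eq)
        then have y: "same_leaf y y1" by (rule connected_component_of_trans[OF s(8)])
        have c: "s O s' \<in> S" "(?z, \<tau> (cc b) u) \<in> s O s'" "(?w, w') \<in> s O s'"
          using comp[rule_format, OF s(3) s'(1)] relcompI[OF s(4) s'(2)] relcompI[OF s(6) w'(1)] by simp_all
        \<comment> \<open>The single step \<open>s'\<close> only keeps the distance below \<open>\<rho>\<close>; equicontinuity of the whole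
            composite brings it back below \<open>\<theta>\<close>, so the bound does not degrade along the chain.\<close>
        have "d (\<tau> (cc b) u) w' < \<theta>"
          using \<delta>(2)[rule_format, OF c(1) zC inC[OF E(2) uv(3)] c(2,3) zw(1) w'(3)] .
        then show ?case
          unfolding pq uv(1)[symmetric]
          using c(3) by (intro followedI[OF E(2) uv(3) c(1,2) y1(2) _ _ y]) (simp_all only: y1(4))
      qed
    qed
    define D where "D = {u. \<exists>a\<in>F. u \<in> W a \<and> ((x', j), (u, a)) \<in> E\<^sup>*}"
    \<comment> \<open>No chain from \<open>x'\<close> to \<open>x\<close> is built by hand: the set
      of endpoints of chains is locally constant along plaques, hence contains the whole
      leaf.\<close>
    have "x \<in> D"
    proof (rule same_leaf_invariant)
      show "same_leaf x' x" by (rule x'_leaf)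
      show "x' \<in> D" unfolding D_def using j(1) xj by blast
      fix u assume "u \<in> topspace X"
      then obtain a where a: "a \<in> F" "u \<in> W a" using F(2) by blast
      \<comment> \<open>The chain may reach \<open>v\<close> under another label \<open>b\<close>;
        it has to switch to \<open>a\<close> before moving along the plaque in
        \<open>W a\<close>.\<close>
      have imp: "v' \<in> D" if vv: "v \<in> W a" "v' \<in> W a" "fb_proj (cc a) v = fb_proj (cc a) v'" "v \<in> D" for v v'
      proof -
        obtain b where b: "b \<in> F" "v \<in> W b" "((x', j), (v, b)) \<in> E\<^sup>*"
          using vv(4) unfolding D_def by blast
        have "((v, b), (v, a)) \<in> E" "((v, a), (v', a)) \<in> E"
          using b(1,2) a(1) vv(1-3) unfolding E_def by auto
        then have "((x', j), (v', a)) \<in> E\<^sup>*"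
          using b(3) by (meson rtrancl.rtrancl_into_rtrancl)
        then show ?thesis unfolding D_def using a(1) vv(2) by blast
      qed
      have "v \<in> D \<longleftrightarrow> u \<in> D" if "v \<in> W a" "fb_proj (cc a) v = fb_proj (cc a) u" for v
        using imp[OF that(1) a(2) that(2)] imp[OF a(2) that(1) that(2)[symmetric]] by blast
      moreover have "W a \<subseteq> fb_dom (cc a)" using WU[OF a(1)] by blast
      ultimately show "\<exists>c\<in>A'. \<exists>W. openin X W \<and> u \<in> W \<and> W \<subseteq> fb_dom c \<and>
          (\<forall>v\<in>W. fb_proj c v = fb_proj c u \<longrightarrow> (v \<in> D \<longleftrightarrow> u \<in> D))"
        by (intro bexI[OF _ cc[OF a(1)]] exI[of _ "W a"] conjI ballI impI W[OF a(1)] a(2))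
    qed
    then obtain a where a: "a \<in> F" "x \<in> W a" "((x', j), (x, a)) \<in> E\<^sup>*" unfolding D_def by blast
    \<comment> \<open>A last change of label, because the target ball was chosen in the box of
      \<open>i\<close>.\<close>
    moreover have "((x, a), (x, i)) \<in> E" using a(1,2) i unfolding E_def by auto
    ultimately have "followed (x, i)" using follow by (meson rtrancl.rtrancl_into_rtrancl)
    then obtain y' where y': "y' \<in> fb_dom (cc i)" "d (\<tau> (cc i) x) (\<tau> (cc i) y') < \<theta>" "same_leaf y y'"
      unfolding followed_def prod.case by (elim bexE conjE) (rule that; assumption)
    then have "\<tau> (cc i) y' \<in> mball (\<tau> (cc i) x) \<epsilon>"
      using \<tau>M[OF cc[OF i(1)]] WU[OF i] by (simp add: \<theta>_def)
    \<comment> \<open>\<open>y'\<close> may lie outside \<open>V\<close>, but the ball is contained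
      in the projection of \<open>V\<close>, so the plaque of \<open>y'\<close> meets
      \<open>V\<close>.\<close>
    then obtain v where v: "v \<in> V" "v \<in> fb_dom (cc i)" "\<tau> (cc i) y' = \<tau> (cc i) v" using \<epsilon>(2) by blast
    then have "same_leaf y' v"
      using same_plaque_imp_same_leaf[of "cc i" y' v] cc[OF i(1)] y'(1) by (simp add: \<tau>_eq)
    then have "same_leaf y v" by (rule connected_component_of_trans[OF y'(3)])
    then show "\<exists>v. v \<in> {v. same_leaf y v} \<and> v \<in> V" using v(1) by blast
  qed
qed

end

theorem corollary17p5:
  fixes n :: nat and k :: enat
    and X :: "'a topology" and A :: "('a, 'z) flow_box set"
  assumes "foliated_space n k X A"
    and "compact_space X"
    and "strongly_equicontinuous_foliated_space n k X A"
  shows "partition_on (topspace X) {X closure_of L |L. L \<in> leaves X A}"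
proof -
  obtain A' where A': "foliated_space n k X A'" "foliated_space n k X (A \<union> A')"
    and se: "strongly_equicontinuous (holonomy_space A') (holonomy_pseudogroup A')"
    using assms(3) unfolding strongly_equicontinuous_foliated_space_def by blast
  interpret compatible_atlases n k X A A' by unfold_locales (fact assms(1) A')+
  define cl where "cl = (\<lambda>x. X closure_of {v. same_leaf x v})"
  have P: "{X closure_of L |L. L \<in> leaves X A} = cl ` topspace X"
    unfolding leaves_def connected_components_of_def topspace_leaf_topology cl_def by blast
  have refl: "x \<in> cl x" if "x \<in> topspace X" for x
  proof -
    have "{v. same_leaf x v} \<subseteq> topspace X"
      using connected_component_of_subset_topspace[of "leaf_topology X A" x]
      by (simp add: topspace_leaf_topology)
    then have "{v. same_leaf x v} \<subseteq> cl x" unfolding cl_def by (rule closure_of_subset)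
    moreover have "same_leaf x x" using that by (simp add: connected_component_of_refl topspace_leaf_topology)
    ultimately show ?thesis by blast
  qed
  have sub: "cl x \<subseteq> topspace X" for x unfolding cl_def by (rule closure_of_subset_topspace)
  \<comment> \<open>Saturation puts the whole leaf of \<open>y\<close> into the closed set
    \<open>cl x\<close>, which then contains its closure.\<close>
  have mono: "cl y \<subseteq> cl x" if "y \<in> cl x" for x y
  proof -
    have "{v. same_leaf y v} \<subseteq> cl x"
      using same_leaf_closure[of y x] that unfolding cl_def by blast
    then show ?thesis unfolding cl_def by (rule closure_of_minimal) simp
  qed
  have sym: "x \<in> cl y" if "x \<in> topspace X" "y \<in> cl x" for x y
    using leaf_closure_symmetric[OF assms(2) se that(1)] that(2) unfolding cl_def by blast
  have eq: "cl x = cl y" if "x \<in> topspace X" "y \<in> cl x" for x y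
    using mono[OF that(2)] mono[OF sym[OF that]] by (rule subset_antisym[rotated])
  show ?thesis
    unfolding P
  proof (rule partition_onI)
    show "\<Union>(cl ` topspace X) = topspace X" using refl sub by blast
    show "{} \<notin> cl ` topspace X" using refl by auto
    fix p q assume "p \<in> cl ` topspace X" "q \<in> cl ` topspace X" "p \<noteq> q"
    then show "disjnt p q" using eq unfolding disjnt_iff by (metis imageE)
  qed
qed

end
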